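(* Let $\mu_0,\mu_1\in\mathcal{P}(\mathbb{R}^d)$ have finite second moments, and let $$BB_2(\mu_0,\mu_1)=\inf\Bigl\{\mathbb{E}\Bigl[\int_0^1|b_t|^2\,\mathrm{d}t\Bigr]\ \Big|\ \mathrm{d}X_t=b_t\,\mathrm{d}t,\ X_0\sim\mu_0,\ X_1\sim\mu_1\Bigr\}.$$ Then $$BB_2(\mu_0,\mu_1)=\sup_{\phi\in C_b(\mathbb{R}^d)}\Bigl\{\int_{\mathbb{R}^d}\phi^c(x)\,\mu_0(\mathrm{d}x)-\int_{\mathbb{R}^d}\phi(y)\,\mu_1(\mathrm{d}y)\Bigr\},$$ where $\phi^c(x)=\inf_{y\in\mathbb{R}^d}\{|x-y|^2+\phi(y)\}$, and the infimum in the definition of $BB_2(\mu_0,\mu_1)$ is achieved whenever it is finite.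
   Context: $\mathcal{P}(\mathbb{R}^d)$ is the set of Borel probability measures on $\mathbb{R}^d$ and $C_b(\mathbb{R}^d)$ the bounded continuous real functions on $\mathbb{R}^d$. The infimum defining $BB_2$ is over (laws of) $\mathbb{R}^d$-valued stochastic processes $X=(X_t)_{0\le t\le1}$ with $X_t=X_0+\int_0^tb_s\,\mathrm{d}s$ a.s., whose drift $b$ may be random (adapted to the filtration of $X$), and with $X_0$ of law $\mu_0$ and $X_1$ of law $\mu_1$. *)

theory Defs
  imports "HOL-Probability.Probability"
begin

definition natural_filtration ::
    "'w measure \<Rightarrow> (real \<Rightarrow> 'w \<Rightarrow> 'a::topological_space) \<Rightarrow> real \<Rightarrow> 'w measure" where
  "natural_filtration M X t =
     sigma (space M) {X s -` A \<inter> space M | s A. s \<in> {0..t} \<and> A \<in> sets borel}"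

text \<open>
  The relation \<open>dX\<^sub>t = b\<^sub>t dt\<close> on \<open>[0,1]\<close>: almost surely,
  \<open>X\<^sub>t = X\<^sub>0 + \<integral>\<^sub>0\<^sup>t b\<^sub>s ds\<close> for all \<open>t \<in> [0,1]\<close>, where the possibly random drift \<open>b\<close> is jointly
  measurable and adapted to the (raw) filtration generated by \<open>X\<close>. Almost sure integrability of
  \<open>b\<close> in time is required explicitly, as the Bochner integral of a non-integrable function is \<open>0\<close>
  by convention. Only times in \<open>[0,1]\<close> matter.
\<close>

definition drift_process ::
    "'w measure \<Rightarrow> (real \<Rightarrow> 'w \<Rightarrow> 'a::euclidean_space) \<Rightarrow> (real \<Rightarrow> 'w \<Rightarrow> 'a) \<Rightarrow> bool" where
  "drift_process M X b \<longleftrightarrow>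
     (\<forall>t\<in>{0..1}. X t \<in> borel_measurable M) \<and>
     (\<lambda>(t, w). b t w) \<in> borel_measurable (restrict_space borel {0..1} \<Otimes>\<^sub>M M) \<and>
     (\<forall>t\<in>{0..1}. b t \<in> borel_measurable (natural_filtration M X t)) \<and>
     (AE w in M. set_integrable lborel {0..1} (\<lambda>s. b s w) \<and>
        (\<forall>t\<in>{0..1}. X t w = X 0 w + (LINT s:{0..t}|lborel. b s w)))"

definition action :: "'w measure \<Rightarrow> (real \<Rightarrow> 'w \<Rightarrow> 'a::real_normed_vector) \<Rightarrow> ennreal" where
  "action M b = (\<integral>\<^sup>+ w. (\<integral>\<^sup>+ t\<in>{0..1}. ennreal ((norm (b t w))\<^sup>2) \<partial>lborel) \<partial>M)"

text \<open>
  The measurable space \<open>C([0,1])\<close> of continuous paths with the \<open>\<sigma>\<close>-algebra generated by the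
  evaluations. Paths are functions on \<open>[0,1]\<close>, extended by \<open>undefined\<close> as in \<^const>\<open>PiM\<close>. Only the
  measurable structure is used.
\<close>

definition path_space :: "(real \<Rightarrow> 'a::topological_space) measure" where
  "path_space = restrict_space (Pi\<^sub>M {0..1} (\<lambda>_. borel)) {w. continuous_on {0..1} w}"

abbreviation (input) coordinate_process :: "real \<Rightarrow> (real \<Rightarrow> 'a) \<Rightarrow> 'a" where
  "coordinate_process \<equiv> \<lambda>t w. w t"

text \<open>
  Since \<open>X\<close> has continuous paths and the drift is a functional of \<open>X\<close>, the competitors are
  represented by the law \<open>P\<close> of \<open>X\<close> on path space, under which \<open>X\<close> is the coordinate process,
  together with the drift functional \<open>b\<close>.
\<close>

definition BB_admissible ::
    "'a::euclidean_space measure \<Rightarrow> 'a measure \<Rightarrow>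
       ((real \<Rightarrow> 'a) measure \<times> (real \<Rightarrow> (real \<Rightarrow> 'a) \<Rightarrow> 'a)) set" where
  "BB_admissible \<mu>0 \<mu>1 =
     {(P, b). prob_space P \<and> sets P = sets path_space \<and>
        drift_process P coordinate_process b \<and>
        distr P borel (coordinate_process 0) = \<mu>0 \<and>
        distr P borel (coordinate_process 1) = \<mu>1}"

definition BB2 :: "'a::euclidean_space measure \<Rightarrow> 'a measure \<Rightarrow> ennreal" where
  "BB2 \<mu>0 \<mu>1 = (INF (P, b) \<in> BB_admissible \<mu>0 \<mu>1. action P b)"

definition c_transform :: "('a::real_normed_vector \<Rightarrow> real) \<Rightarrow> 'a \<Rightarrow> real" where
  "c_transform \<phi> x = (INF y. (norm (x - y))\<^sup>2 + \<phi> y)"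

end

theory Submission
  imports Defs
begin

text \<open>
  The problem reduces to optimal transport with the quadratic cost \<open>|x - y|\<^sup>2\<close>.

  A process with drift \<open>b\<close> has displacement \<open>X\<^sub>1 - X\<^sub>0\<close> equal to the time integral of \<open>b\<close>, so by
  Cauchy-Schwarz its action is at least the expectation of \<open>|X\<^sub>0 - X\<^sub>1|\<^sup>2\<close>, which in turn is at least every
  dual value (\<open>dual_le_action\<close>). Conversely, a coupling \<open>\<pi>\<close> of the marginals is lifted to the law of the
  straight path from \<open>x\<close> to \<open>y\<close> run at constant speed, with \<open>(x, y)\<close> distributed by \<open>\<pi>\<close>. Along that path
  the velocity can be read off from the past as \<open>(X\<^sub>t - X\<^sub>0) / t\<close>, so the drift is adapted, and the action
  is the transport cost of \<open>\<pi>\<close> (\<open>segment_lift\<close>). It remains to find one coupling whose cost is at most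
  the supremum of the dual values; its lift then closes the chain of inequalities and attains the
  infimum.

  That coupling is any optimal one. It exists by compactness (\<open>optimal_coupling_exists\<close>): a
  minimizing sequence of couplings, regarded as set functions, has a cluster point by Tychonoff's
  theorem; the cluster point is a priori only finitely additive, but since its marginals are the fixed measures,
  compact approximation of rectangles and Caratheodory's theorem produce a coupling of no larger
  cost. Its support is cyclically monotone, as otherwise mass could be exchanged along a cycle at a
  profit (\<open>optimal_coupling_cyclically_monotone\<close>). Rockafellar's construction supplies potentials on
  the support with equality \<open>\<psi> x - \<phi> y = |x - y|\<^sup>2\<close> (\<open>cyclically_monotone_potentials\<close>). Truncating and
  conjugating them gives functions in \<open>C\<^sub>b\<close> whose dual values converge to the cost of the coupling
  (\<open>cyclically_monotone_dual_approximation\<close>).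
\<close>

section \<open>Couplings\<close>

definition couplings ::
    "'a::topological_space measure \<Rightarrow> 'b::topological_space measure \<Rightarrow> ('a \<times> 'b) measure set" where
  "couplings \<mu> \<nu> = {\<pi>. sets \<pi> = sets borel \<and> distr \<pi> borel fst = \<mu> \<and> distr \<pi> borel snd = \<nu>}"

lemma borel_measurable_fst_borel [measurable]:
  "(fst :: 'a::topological_space \<times> 'b::topological_space \<Rightarrow> 'a) \<in> borel_measurable borel"
  by (intro borel_measurable_continuous_onI continuous_on_fst continuous_on_id)

lemma borel_measurable_snd_borel [measurable]:
  "(snd :: 'a::topological_space \<times> 'b::topological_space \<Rightarrow> 'b) \<in> borel_measurable borel"
  by (intro borel_measurable_continuous_onI continuous_on_snd continuous_on_id)

lemma Times_UNIV_borel: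
  fixes A :: "'a::topological_space set"
  assumes "A \<in> sets borel"
  shows "A \<times> (UNIV :: 'b::topological_space set) \<in> sets borel"
proof -
  have "fst -` A \<inter> space borel = A \<times> (UNIV :: 'b set)" by auto
  then show ?thesis
    using measurable_sets[OF borel_measurable_fst_borel assms] by metis
qed

lemma UNIV_Times_borel:
  fixes B :: "'b::topological_space set"
  assumes "B \<in> sets borel"
  shows "(UNIV :: 'a::topological_space set) \<times> B \<in> sets borel"
proof -
  have "snd -` B \<inter> space borel = (UNIV :: 'a set) \<times> B" by auto
  then show ?thesis
    using measurable_sets[OF borel_measurable_snd_borel assms] by metis
qed

lemma Times_borel:
  fixes A :: "'a::topological_space set" and B :: "'b::topological_space set"
  assumes "A \<in> sets borel" "B \<in> sets borel"
  shows "A \<times> B \<in> sets borel"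
proof -
  have "A \<times> B = (A \<times> UNIV) \<inter> (UNIV \<times> B)" by auto
  then show ?thesis
    using Times_UNIV_borel[OF assms(1)] UNIV_Times_borel[OF assms(2)] by (metis sets.Int)
qed

lemma couplingsD:
  assumes "\<pi> \<in> couplings \<mu> \<nu>"
  shows couplings_sets: "sets \<pi> = sets borel"
    and couplings_space: "space \<pi> = UNIV"
    and couplings_fst: "distr \<pi> borel fst = \<mu>"
    and couplings_snd: "distr \<pi> borel snd = \<nu>"
    and couplings_measurable_fst: "fst \<in> borel_measurable \<pi>"
    and couplings_measurable_snd: "snd \<in> borel_measurable \<pi>"
proof -
  show s: "sets \<pi> = sets borel" and "distr \<pi> borel fst = \<mu>" "distr \<pi> borel snd = \<nu>"
    using assms by (auto simp: couplings_def)
  show "space \<pi> = UNIV" using sets_eq_imp_space_eq[OF s] by simp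
  show "fst \<in> borel_measurable \<pi>" "snd \<in> borel_measurable \<pi>"
    by (simp_all add: measurable_cong_sets[OF s refl])
qed

lemma couplings_prob_space:
  assumes "\<pi> \<in> couplings \<mu> \<nu>" "prob_space \<mu>"
  shows "prob_space \<pi>"
  using assms couplings_measurable_fst[OF assms(1)] couplings_fst[OF assms(1)]
  by (metis prob_space_distrD)

lemma couplings_emeasure:
  assumes "\<pi> \<in> couplings \<mu> \<nu>"
  shows "A \<in> sets borel \<Longrightarrow> emeasure \<pi> (A \<times> UNIV) = emeasure \<mu> A"
    and "B \<in> sets borel \<Longrightarrow> emeasure \<pi> (UNIV \<times> B) = emeasure \<nu> B"
proof -
  have "fst -` A \<inter> space \<pi> = A \<times> UNIV" "snd -` B \<inter> space \<pi> = UNIV \<times> B"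
    using couplings_space[OF assms] by auto
  then show "A \<in> sets borel \<Longrightarrow> emeasure \<pi> (A \<times> UNIV) = emeasure \<mu> A"
    "B \<in> sets borel \<Longrightarrow> emeasure \<pi> (UNIV \<times> B) = emeasure \<nu> B"
    using emeasure_distr[OF couplings_measurable_fst[OF assms], of A]
      emeasure_distr[OF couplings_measurable_snd[OF assms], of B]
      couplings_fst[OF assms] couplings_snd[OF assms] by auto
qed

lemma couplingsI:
  assumes s: "sets \<pi> = sets borel"
    and \<mu>: "sets \<mu> = sets borel" "\<And>A. A \<in> sets borel \<Longrightarrow> emeasure \<pi> (A \<times> UNIV) = emeasure \<mu> A"
    and \<nu>: "sets \<nu> = sets borel" "\<And>B. B \<in> sets borel \<Longrightarrow> emeasure \<pi> (UNIV \<times> B) = emeasure \<nu> B"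
  shows "\<pi> \<in> couplings \<mu> \<nu>"
proof -
  have sp: "space \<pi> = UNIV" using sets_eq_imp_space_eq[OF s] by simp
  have m: "fst \<in> borel_measurable \<pi>" "snd \<in> borel_measurable \<pi>"
    by (simp_all add: measurable_cong_sets[OF s refl])
  have "emeasure (distr \<pi> borel fst) A = emeasure \<mu> A" if "A \<in> sets borel" for A
  proof -
    have "fst -` A \<inter> space \<pi> = A \<times> UNIV" using sp by auto
    then show ?thesis using emeasure_distr[OF m(1) that] \<mu>(2)[OF that] by simp
  qed
  moreover have "emeasure (distr \<pi> borel snd) A = emeasure \<nu> A" if "A \<in> sets borel" for A
  proof -
    have "snd -` A \<inter> space \<pi> = UNIV \<times> A" using sp by auto
    then show ?thesis using emeasure_distr[OF m(2) that] \<nu>(2)[OF that] by simp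
  qed
  ultimately show ?thesis
    using s \<mu>(1) \<nu>(1) by (auto simp: couplings_def intro!: measure_eqI)
qed

section \<open>Weak limits of couplings\<close>

lemma compact_inner_regular:
  fixes \<mu> :: "'a::polish_space measure"
  assumes "prob_space \<mu>" "sets \<mu> = sets borel" "A \<in> sets borel" "0 < e"
  obtains K where "compact K" "K \<subseteq> A" "measure \<mu> (A - K) < e"
proof -
  interpret prob_space \<mu> by fact
  have "emeasure \<mu> A = (SUP K\<in>{K. K \<subseteq> A \<and> compact K}. emeasure \<mu> K)"
    by (rule inner_regular) (use assms in auto)
  moreover have "emeasure \<mu> A < (SUP K\<in>{K. K \<subseteq> A \<and> compact K}. emeasure \<mu> K + ennreal e)"
  proof -
    have "(SUP K\<in>{K. K \<subseteq> A \<and> compact K}. emeasure \<mu> K + ennreal e)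
        = (SUP K\<in>{K. K \<subseteq> A \<and> compact K}. emeasure \<mu> K) + ennreal e"
      by (rule ennreal_SUP_add_left) auto
    then show ?thesis
      using calculation assms(4) by (metis emeasure_finite ennreal_less_zero_iff ennreal_add_left_cancel_less add_0_right infinity_ennreal_def top.not_eq_extremum)
  qed
  ultimately obtain K where K: "K \<subseteq> A" "compact K" "emeasure \<mu> A < emeasure \<mu> K + ennreal e"
    by (auto simp: less_SUP_iff)
  have s: "K \<in> sets \<mu>" "A \<in> sets \<mu>" using K(2) assms by (auto intro: borel_compact)
  have "measure \<mu> A < measure \<mu> K + e"
    using K(3) assms(4) by (simp add: emeasure_eq_measure ennreal_less_iff flip: ennreal_plus)
  then have "measure \<mu> (A - K) < e" using finite_measure_Diff[OF s(2,1) K(1)] by simp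
  then show thesis using K that by blast
qed

text \<open>
  Approximability from inside by compact sets is the only source of countable additivity below: a
  decreasing sequence of compact sets with empty intersection is eventually empty.
\<close>

definition set_approximable :: "('a::topological_space set \<Rightarrow> real) \<Rightarrow> 'a set \<Rightarrow> bool" where
  "set_approximable m S \<longleftrightarrow> (\<forall>e>0. \<exists>C\<subseteq>S. compact C \<and> m (S - C) < e)"

locale borel_content =
  fixes m :: "'a::t2_space set \<Rightarrow> real"
  assumes nonneg: "S \<in> sets borel \<Longrightarrow> 0 \<le> m S"
    and additive: "S \<in> sets borel \<Longrightarrow> T \<in> sets borel \<Longrightarrow> S \<inter> T = {} \<Longrightarrow> m (S \<union> T) = m S + m T"
begin

lemma empty: "m {} = 0"
  using additive[of "{}" "{}"] by simp

lemma mono: "S \<in> sets borel \<Longrightarrow> T \<in> sets borel \<Longrightarrow> S \<subseteq> T \<Longrightarrow> m S \<le> m T"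
  using additive[of S "T - S"] nonneg[of "T - S"] by (auto simp: Un_absorb1)

lemma Diff: "S \<in> sets borel \<Longrightarrow> T \<in> sets borel \<Longrightarrow> S \<subseteq> T \<Longrightarrow> m (T - S) = m T - m S"
  using additive[of S "T - S"] by (auto simp: Un_absorb1)

lemma subadditive: "S \<in> sets borel \<Longrightarrow> T \<in> sets borel \<Longrightarrow> m (S \<union> T) \<le> m S + m T"
  using additive[of S "T - S"] mono[of "T - S" T] by auto

lemma approximable_mono:
  assumes "\<And>e. 0 < e \<Longrightarrow> \<exists>C\<subseteq>S. compact C \<and> (\<exists>T\<in>sets borel. S - C \<subseteq> T \<and> m T < e)" "S \<in> sets borel"
  shows "set_approximable m S"
  unfolding set_approximable_def
proof (intro allI impI)
  fix e :: real assume "0 < e"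
  from assms(1)[OF this] obtain C T where C: "C \<subseteq> S" "compact C" "T \<in> sets borel" "S - C \<subseteq> T" "m T < e"
    by blast
  have "m (S - C) \<le> m T"
    by (intro mono sets.Diff assms(2) borel_compact C)
  then have "m (S - C) < e" using C(5) by simp
  then show "\<exists>C\<subseteq>S. compact C \<and> m (S - C) < e" using C(1,2) by blast
qed

lemma approximable_Un:
  assumes "set_approximable m S" "S \<in> sets borel" "set_approximable m T" "T \<in> sets borel"
  shows "set_approximable m (S \<union> T)"
  unfolding set_approximable_def
proof (intro allI impI)
  fix e :: real assume "0 < e"
  then obtain C D where C: "C \<subseteq> S" "compact C" "m (S - C) < e/2"
    and D: "D \<subseteq> T" "compact D" "m (T - D) < e/2"
    using assms(1,3) unfolding set_approximable_def by (meson half_gt_zero)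
  have [measurable]: "C \<in> sets borel" "D \<in> sets borel" using C D by (auto intro: borel_compact)
  have "m (S \<union> T - (C \<union> D)) \<le> m ((S - C) \<union> (T - D))"
    using assms by (intro mono) auto
  also have "\<dots> < e" using subadditive[of "S - C" "T - D"] C D assms by auto
  finally show "\<exists>C\<subseteq>S \<union> T. compact C \<and> m (S \<union> T - C) < e"
    using C D by (intro exI[of _ "C \<union> D"]) auto
qed

lemma approximable_Int:
  assumes "set_approximable m S" "S \<in> sets borel" "set_approximable m T" "T \<in> sets borel"
  shows "set_approximable m (S \<inter> T)"
  unfolding set_approximable_def
proof (intro allI impI)
  fix e :: real assume "0 < e"
  then obtain C D where C: "C \<subseteq> S" "compact C" "m (S - C) < e/2"
    and D: "D \<subseteq> T" "compact D" "m (T - D) < e/2"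
    using assms(1,3) unfolding set_approximable_def by (meson half_gt_zero)
  have [measurable]: "C \<in> sets borel" "D \<in> sets borel" using C D by (auto intro: borel_compact)
  have "m (S \<inter> T - (C \<inter> D)) \<le> m ((S - C) \<union> (T - D))"
    using assms by (intro mono) auto
  also have "\<dots> < e" using subadditive[of "S - C" "T - D"] C D assms by auto
  finally show "\<exists>C\<subseteq>S \<inter> T. compact C \<and> m (S \<inter> T - C) < e"
    using C D by (intro exI[of _ "C \<inter> D"]) (auto intro: compact_Int)
qed

text \<open>
  Requiring approximability of the complement as well makes closure under complements automatic, so
  that these sets form an algebra without any normal form for finite unions of rectangles.
\<close>

definition regular_sets :: "'a set set" where
  "regular_sets = {S \<in> sets borel. set_approximable m S \<and> set_approximable m (- S)}"

lemma algebra_regular_sets: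
  assumes "set_approximable m UNIV"
  shows "algebra UNIV regular_sets"
proof -
  have "set_approximable m {}" using empty by (auto simp: set_approximable_def)
  then show ?thesis
    unfolding algebra_iff_Un regular_sets_def
    using assms approximable_Un approximable_Int
    by (auto simp flip: Compl_eq_Diff_UNIV)
qed

text \<open>
  Continuity at the empty set. If \<open>S i\<close> decreases to \<open>{}\<close>, choose compact \<open>C i \<subseteq> S i\<close> losing at most
  \<open>e / 2 ^ (i + 1)\<close>. The finite intersections of the \<open>C i\<close> lose less than \<open>e\<close> altogether, and one of them
  is empty, so \<open>m (S n) < e\<close> for some \<open>n\<close>.
\<close>

lemma regular_sets_continuous:
  assumes S: "range S \<subseteq> regular_sets" "decseq S" "(\<Inter>i. S i) = {}"
  shows "(\<lambda>i. m (S i)) \<longlonglongrightarrow> 0"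
proof -
  have Sb [measurable]: "S i \<in> sets borel" for i using S(1) by (auto simp: regular_sets_def)
  have "\<exists>n. m (S n) < e" if "0 < e" for e
  proof -
    have "\<exists>C\<subseteq>S i. compact C \<and> m (S i - C) < e * (1/2)^Suc i" for i
    proof -
      have "set_approximable m (S i)" using S(1) by (auto simp: regular_sets_def)
      moreover have "0 < e * (1/2)^Suc i" using that by simp
      ultimately show ?thesis unfolding set_approximable_def by blast
    qed
    then obtain C where C: "\<And>i. C i \<subseteq> S i" "\<And>i. compact (C i)"
      "\<And>i. m (S i - C i) < e * (1/2)^Suc i" by metis
    have Cb [measurable]: "C i \<in> sets borel" for i using C(2) by (auto intro: borel_compact)
    have le: "m (S n - (\<Inter>i\<le>n. C i)) \<le> (\<Sum>i\<le>n. e * (1/2)^Suc i)" for n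
    proof (induction n)
      case 0 then show ?case using C(3)[of 0] by simp
    next
      case (Suc n)
      have fin: "(\<Inter>i\<le>n. C i) \<in> sets borel" for n by (intro sets.finite_INT) auto
      have "S (Suc n) \<subseteq> S n" using S(2) by (auto simp: decseq_Suc_iff)
      then have "m (S (Suc n) - (\<Inter>i\<le>Suc n. C i)) \<le> m ((S n - (\<Inter>i\<le>n. C i)) \<union> (S (Suc n) - C (Suc n)))"
        using fin by (intro mono sets.Un sets.Diff) (auto simp: atMost_Suc)
      also have "\<dots> \<le> m (S n - (\<Inter>i\<le>n. C i)) + m (S (Suc n) - C (Suc n))"
        using fin by (intro subadditive sets.Diff) auto
      also have "\<dots> \<le> (\<Sum>i\<le>n. e * (1/2)^Suc i) + e * (1/2)^Suc (Suc n)"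
        using Suc C(3)[of "Suc n"] by simp
      finally show ?case by simp
    qed
    have geo: "(\<Sum>i\<le>n. e * (1/2)^Suc i) < e" for n
    proof -
      have "(\<Sum>i\<le>n. e * (1/2)^Suc i) = e - e * (1/2)^Suc n"
        by (induction n) (auto simp: algebra_simps)
      moreover have "0 < e * (1/2)^Suc n" using that by simp
      ultimately show ?thesis by linarith
    qed
    have "(\<Inter>i. C i) = {}" using S(3) C(1) by blast
    then have "C 0 \<inter> (\<Inter>i\<in>UNIV. C i) = {}" by auto
    then obtain I where I: "finite I" "C 0 \<inter> (\<Inter>i\<in>I. C i) = {}"
      using compact_imp_fip_image[OF C(2), of UNIV C 0] C(2) compact_imp_closed by (metis subset_UNIV)
    define n where "n = Max (insert 0 I)"
    have "0 \<le> n" "I \<subseteq> {..n}" using I(1) by (auto simp: n_def)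
    then have "(\<Inter>i\<le>n. C i) = {}" using I(2) by fastforce
    then have "m (S n) < e" using le[of n] geo[of n] by simp
    then show ?thesis by blast
  qed
  moreover have "m (S j) \<le> m (S i)" if "i \<le> j" for i j
    using S(2) that by (intro mono) (auto simp: decseq_def)
  ultimately show ?thesis
    using nonneg[OF Sb] by (intro LIMSEQ_I) (metis (no_types) abs_of_nonneg diff_zero le_less_trans real_norm_def)
qed

lemma regular_sets_extend:
  assumes "set_approximable m UNIV"
  obtains \<pi> where "sets \<pi> = sigma_sets UNIV regular_sets" "\<And>S. S \<in> regular_sets \<Longrightarrow> emeasure \<pi> S = ennreal (m S)"
proof -
  interpret algebra UNIV regular_sets by (rule algebra_regular_sets) fact
  have b: "S \<in> regular_sets \<Longrightarrow> S \<in> sets borel" for S by (auto simp: regular_sets_def)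
  have "\<exists>\<mu>. (\<forall>S\<in>regular_sets. \<mu> S = ennreal (m S)) \<and> measure_space UNIV (sigma_sets UNIV regular_sets) \<mu>"
  proof (rule caratheodory_empty_continuous)
    show "positive regular_sets (\<lambda>S. ennreal (m S))" by (simp add: positive_def empty)
    show "Measure_Space.additive regular_sets (\<lambda>S. ennreal (m S))"
      by (auto simp: Measure_Space.additive_def additive b nonneg ennreal_plus)
    show "(\<lambda>i. ennreal (m (A i))) \<longlonglongrightarrow> 0"
      if "range A \<subseteq> regular_sets" "decseq A" "(\<Inter>i. A i) = {}" for A
      using tendsto_ennrealI[OF regular_sets_continuous[OF that]] by simp
  qed auto
  then obtain \<mu> where \<mu>: "\<And>S. S \<in> regular_sets \<Longrightarrow> \<mu> S = ennreal (m S)"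
    "measure_space UNIV (sigma_sets UNIV regular_sets) \<mu>" by blast
  define \<pi> where "\<pi> = measure_of UNIV regular_sets \<mu>"
  have s: "sets \<pi> = sigma_sets UNIV regular_sets" by (simp add: \<pi>_def)
  have "emeasure \<pi> S = \<mu> S" if "S \<in> sets \<pi>" for S
    using \<mu>(2) that by (intro emeasure_measure_of[OF \<pi>_def]) (auto simp: measure_space_def s)
  then show thesis using that[of \<pi>] s \<mu>(1) by (auto intro: sigma_sets.Basic)
qed

end

text \<open>
  A content on the product may fail to be countably additive, for instance when it is a limit along an
  ultrafilter. Countably additive marginals on Polish spaces repair this: the part of \<open>A \<times> B\<close>
  outside \<open>K \<times> L\<close> is controlled by the marginal masses of \<open>A - K\<close> and \<open>B - L\<close>, so all rectangles are
  approximable by compact ones.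
\<close>

locale coupling_content = borel_content m
  for m :: "('a::polish_space \<times> 'b::polish_space) set \<Rightarrow> real" +
  fixes \<mu> :: "'a measure" and \<nu> :: "'b measure"
  assumes prob_\<mu>: "prob_space \<mu>" and sets_\<mu>: "sets \<mu> = sets borel"
    and prob_\<nu>: "prob_space \<nu>" and sets_\<nu>: "sets \<nu> = sets borel"
    and fst_marginal: "A \<in> sets borel \<Longrightarrow> m (A \<times> UNIV) = measure \<mu> A"
    and snd_marginal: "B \<in> sets borel \<Longrightarrow> m (UNIV \<times> B) = measure \<nu> B"
begin

lemma approximable_Times:
  assumes A: "A \<in> sets borel" and B: "B \<in> sets borel"
  shows "set_approximable m (A \<times> B)"
proof (rule approximable_mono)
  fix e :: real assume "0 < e"
  then have e: "0 < e / 2" by simp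
  obtain K where K: "compact K" "K \<subseteq> A" "measure \<mu> (A - K) < e/2"
    by (rule compact_inner_regular[OF prob_\<mu> sets_\<mu> A e])
  obtain L where L: "compact L" "L \<subseteq> B" "measure \<nu> (B - L) < e/2"
    by (rule compact_inner_regular[OF prob_\<nu> sets_\<nu> B e])
  have d [measurable]: "A - K \<in> sets borel" "B - L \<in> sets borel"
    using A B K L by (auto intro: borel_compact)
  define T where "T = (A - K) \<times> UNIV \<union> UNIV \<times> (B - L)"
  have "m T \<le> m ((A - K) \<times> UNIV) + m (UNIV \<times> (B - L))"
    unfolding T_def by (intro subadditive Times_UNIV_borel UNIV_Times_borel d)
  also have "\<dots> < e" using K L fst_marginal[OF d(1)] snd_marginal[OF d(2)] by simp
  finally have lt: "m T < e" .
  have T: "T \<in> sets borel" unfolding T_def by (intro sets.Un Times_UNIV_borel UNIV_Times_borel d)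
  have sub: "A \<times> B - K \<times> L \<subseteq> T" unfolding T_def by fast
  have KL: "K \<times> L \<subseteq> A \<times> B" "compact (K \<times> L)"
    using Sigma_mono[OF K(2) L(2)] compact_Times[OF K(1) L(1)] by simp_all
  show "\<exists>C\<subseteq>A \<times> B. compact C \<and> (\<exists>T\<in>sets borel. A \<times> B - C \<subseteq> T \<and> m T < e)"
    by (intro exI[of _ "K \<times> L"] bexI[of _ T] conjI KL T sub lt)
qed (rule Times_borel[OF A B])

lemma regular_Times:
  assumes A: "A \<in> sets borel" and B: "B \<in> sets borel"
  shows "A \<times> B \<in> regular_sets"
proof -
  have c: "- A \<in> sets borel" "- B \<in> sets borel" using A B by (simp_all add: borel_comp)
  have u: "(UNIV :: 'a set) \<in> sets borel" "(UNIV :: 'b set) \<in> sets borel" by simp_all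
  have eq: "- (A \<times> B) = (- A) \<times> UNIV \<union> UNIV \<times> (- B)" by fast
  have "set_approximable m (- (A \<times> B))"
    unfolding eq
    by (intro approximable_Un approximable_Times Times_borel c u)
  then show ?thesis
    by (simp add: regular_sets_def approximable_Times[OF A B] Times_borel[OF A B])
qed

lemma sigma_sets_regular: "sigma_sets UNIV regular_sets = sets borel"
proof
  have "regular_sets \<subseteq> sets borel" unfolding regular_sets_def by (rule Collect_restrict)
  then show "sigma_sets UNIV regular_sets \<subseteq> sets borel"
    using sets.sigma_sets_subset[of regular_sets borel] by simp
  have "sets (borel :: ('a \<times> 'b) measure) = sigma_sets UNIV {A \<times> B |A B. A \<in> sets borel \<and> B \<in> sets borel}"
    unfolding borel_prod[symmetric] sets_pair_measure space_borel UNIV_Times_UNIV ..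
  also have "\<dots> \<subseteq> sigma_sets UNIV regular_sets"
    by (rule sigma_sets_mono', clarify, rule regular_Times)
  finally show "sets borel \<subseteq> sigma_sets UNIV regular_sets" .
qed

text \<open>
  The Caratheodory extension agrees with \<open>m\<close> on rectangles, hence has the same marginals. An open set is
  an increasing union of finite unions of open rectangles, which gives the inequality for open sets; it
  may be strict, since \<open>m\<close> need not be continuous along such a union.
\<close>

lemma obtain_coupling:
  obtains \<pi> where "\<pi> \<in> couplings \<mu> \<nu>" "\<And>U. open U \<Longrightarrow> measure \<pi> U \<le> m U"
proof -
  have U: "UNIV \<in> regular_sets" using regular_Times[of UNIV UNIV] by simp
  then have app: "set_approximable m UNIV" by (simp add: regular_sets_def)
  then interpret algebra UNIV regular_sets by (rule algebra_regular_sets)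
  obtain \<pi> where \<pi>: "sets \<pi> = sets borel" "\<And>S. S \<in> regular_sets \<Longrightarrow> emeasure \<pi> S = ennreal (m S)"
    using regular_sets_extend[OF app] unfolding sigma_sets_regular by blast
  interpret \<mu>: prob_space \<mu> by (rule prob_\<mu>)
  interpret \<nu>: prob_space \<nu> by (rule prob_\<nu>)
  have "\<pi> \<in> couplings \<mu> \<nu>"
  proof (rule couplingsI[OF \<pi>(1) sets_\<mu> _ sets_\<nu>])
    show "emeasure \<pi> (A \<times> UNIV) = emeasure \<mu> A" if "A \<in> sets borel" for A
      using \<pi>(2)[OF regular_Times[OF that, of UNIV]] fst_marginal[OF that]
      by (simp add: \<mu>.emeasure_eq_measure)
    show "emeasure \<pi> (UNIV \<times> B) = emeasure \<nu> B" if "B \<in> sets borel" for B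
      using \<pi>(2)[OF regular_Times[OF _ that, of UNIV]] snd_marginal[OF that]
      by (simp add: \<nu>.emeasure_eq_measure)
  qed
  moreover have "measure \<pi> U \<le> m U" if U: "open U" for U
  proof -
    obtain \<A> :: "'a set set" where \<A>: "countable \<A>" "topological_basis \<A>"
      using ex_countable_basis by blast
    obtain \<B> :: "'b set set" where \<B>: "countable \<B>" "topological_basis \<B>"
      using ex_countable_basis by blast
    have basis: "topological_basis ((\<lambda>(A, B). A \<times> B) ` (\<A> \<times> \<B>))"
      by (rule topological_basis_prod[OF \<A>(2) \<B>(2)])
    have "\<exists>\<C>\<subseteq>(\<lambda>(A, B). A \<times> B) ` (\<A> \<times> \<B>). \<Union>\<C> = U"
      using conjunct2[OF basis[unfolded topological_basis_def], rule_format, OF U] .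
    then obtain \<C> where \<C>: "\<C> \<subseteq> (\<lambda>(A, B). A \<times> B) ` (\<A> \<times> \<B>)" "\<Union>\<C> = U"
      by (elim exE conjE) (rule that)
    have Cr: "C \<in> regular_sets" if C: "C \<in> \<C>" for C
    proof -
      have "C \<in> (\<lambda>(A, B). A \<times> B) ` (\<A> \<times> \<B>)" using C \<C>(1) by (rule rev_subsetD)
      then obtain A B where "C = A \<times> B" "A \<in> \<A>" "B \<in> \<B>" by (elim imageE SigmaE) simp
      then show ?thesis
        using topological_basis_open[OF \<A>(2)] topological_basis_open[OF \<B>(2)]
        by (simp add: regular_Times borel_open)
    qed
    have "countable \<C>" using \<C>(1) \<A>(1) \<B>(1) by (meson countable_SIGMA countable_image countable_subset)
    have "emeasure \<pi> U \<le> ennreal (m U)"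
    proof (cases "\<C> = {}")
      case True then show ?thesis using \<C>(2) by auto
    next
      case False
      define D where "D = from_nat_into \<C>"
      have D: "range D = \<C>" unfolding D_def by (rule range_from_nat_into[OF False \<open>countable \<C>\<close>])
      have "(\<Union>i. (\<Union>j\<le>i. D j)) = U" using \<C>(2) D by auto
      moreover have r: "(\<Union>j\<le>i. D j) \<in> regular_sets" for i using D Cr by (intro finite_UN) auto
      moreover have "incseq (\<lambda>i. \<Union>j\<le>i. D j)" by (intro incseq_SucI UN_mono) simp_all
      ultimately have "emeasure \<pi> U = (SUP i. emeasure \<pi> (\<Union>j\<le>i. D j))"
        using \<pi>(1) by (subst SUP_emeasure_incseq) (auto simp: regular_sets_def)
      also have "\<dots> \<le> ennreal (m U)"
      proof (rule SUP_least)
        fix i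
        have "m (\<Union>j\<le>i. D j) \<le> m U"
          using r[of i] U D \<C>(2) by (intro mono) (auto simp: regular_sets_def)
        then show "emeasure \<pi> (\<Union>j\<le>i. D j) \<le> ennreal (m U)"
          using \<pi>(2)[OF r] by (simp add: ennreal_leI)
      qed
      finally show ?thesis .
    qed
    then show ?thesis using nonneg[of U] U by (simp add: measure_def enn2real_leI)
  qed
  ultimately show thesis using that by blast
qed

end

lemma couplings_nonempty:
  fixes \<mu> :: "'a::second_countable_topology measure" and \<nu> :: "'b::second_countable_topology measure"
  assumes "prob_space \<mu>" "sets \<mu> = sets borel" "prob_space \<nu>" "sets \<nu> = sets borel"
  shows "\<mu> \<Otimes>\<^sub>M \<nu> \<in> couplings \<mu> \<nu>"
proof (rule couplingsI)
  interpret \<mu>: prob_space \<mu> by fact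
  interpret \<nu>: prob_space \<nu> by fact
  interpret pair_sigma_finite \<mu> \<nu> ..
  have sp: "space \<mu> = UNIV" "space \<nu> = UNIV"
    using sets_eq_imp_space_eq[OF assms(2)] sets_eq_imp_space_eq[OF assms(4)] by simp_all
  show "sets (\<mu> \<Otimes>\<^sub>M \<nu>) = sets borel"
    using sets_pair_measure_cong[OF assms(2,4)] unfolding borel_prod .
  show "emeasure (\<mu> \<Otimes>\<^sub>M \<nu>) (A \<times> UNIV) = emeasure \<mu> A" if "A \<in> sets borel" for A
    using \<nu>.emeasure_pair_measure_Times[of A \<mu> UNIV] that assms sp \<nu>.emeasure_space_1 by simp
  show "emeasure (\<mu> \<Otimes>\<^sub>M \<nu>) (UNIV \<times> B) = emeasure \<nu> B" if "B \<in> sets borel" for B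
    using \<nu>.emeasure_pair_measure_Times[of UNIV \<mu> B] that assms sp \<mu>.emeasure_space_1 by simp
qed (use assms in auto)

text \<open>
  Compactness of the set of couplings. By Tychonoff, the set functions \<open>measure (p n)\<close> have a cluster
  point \<open>m\<close> in the product of unit intervals indexed by all sets. Finite additivity and the marginals are
  closed conditions, so they pass to \<open>m\<close>. The last conclusion is the open-set half of the portmanteau
  theorem, \<open>\<pi> U \<le> lim p n U\<close> along \<open>F\<close>.
\<close>

lemma couplings_cluster:
  fixes \<mu> :: "'a::polish_space measure" and \<nu> :: "'b::polish_space measure"
  assumes \<mu>: "prob_space \<mu>" "sets \<mu> = sets borel" and \<nu>: "prob_space \<nu>" "sets \<nu> = sets borel"
    and p: "\<And>n. p n \<in> couplings \<mu> \<nu>"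
  obtains F :: "nat filter" and m \<pi> where "F \<noteq> bot" "F \<le> sequentially"
    "\<And>S. ((\<lambda>n. measure (p n) S) \<longlongrightarrow> m S) F"
    "\<pi> \<in> couplings \<mu> \<nu>" "\<And>U. open U \<Longrightarrow> measure \<pi> U \<le> m U"
proof -
  have prob: "prob_space (p n)" for n using couplings_prob_space[OF p \<mu>(1)] .
  define X :: "nat \<Rightarrow> ('a \<times> 'b) set \<Rightarrow> real" where "X n = measure (p n)" for n
  have "compactin (product_topology (\<lambda>_. euclideanreal) UNIV) (PiE UNIV (\<lambda>_ :: ('a \<times> 'b) set. {0..1}))"
    unfolding compactin_PiE by simp
  then have cpt: "compact (PiE UNIV (\<lambda>_ :: ('a \<times> 'b) set. {0..1::real}))"
    by (simp add: euclidean_product_topology)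
  moreover have "filtermap X sequentially \<noteq> bot" by (simp add: filtermap_bot_iff)
  moreover have "eventually (\<lambda>f. f \<in> PiE UNIV (\<lambda>_. {0..1})) (filtermap X sequentially)"
    using prob by (auto simp: eventually_filtermap X_def prob_space.prob_le_1 PiE_def Pi_def extensional_def)
  ultimately obtain m where m: "inf (nhds m) (filtermap X sequentially) \<noteq> bot"
    unfolding compact_filter by blast
  \<comment> \<open>A filter on the indices is used instead of a subsequence: the product is not metrizable, so a
    cluster point need not be the limit of a subsequence.\<close>
  define F where "F = inf (filtercomap X (nhds m)) sequentially"
  have "F \<noteq> bot"
  proof
    assume "F = bot"
    then have "eventually (\<lambda>_. False) F" by simp
    then obtain P Q where PQ: "eventually P (filtercomap X (nhds m))" "eventually Q sequentially" "\<And>n. P n \<Longrightarrow> Q n \<Longrightarrow> False"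
      unfolding F_def eventually_inf by blast
    then obtain R where R: "eventually R (nhds m)" "\<And>n. R (X n) \<Longrightarrow> P n"
      by (auto simp: eventually_filtercomap)
    have "eventually (\<lambda>f. \<not> R f) (filtermap X sequentially)"
      unfolding eventually_filtermap using PQ(2) by eventually_elim (use PQ R in blast)
    with R(1) have "eventually (\<lambda>_. False) (inf (nhds m) (filtermap X sequentially))"
      unfolding eventually_inf by blast
    with m show False by simp
  qed
  have "filterlim X (nhds m) F"
    unfolding F_def by (rule filterlim_mono[OF filterlim_filtercomap order.refl inf.cobounded1])
  then have lim: "((\<lambda>n. X n S) \<longlongrightarrow> m S) F" for S
    by (rule continuous_on_tendsto_compose[OF continuous_on_product_coordinates]) simp_all
  have F: "F \<le> sequentially" by (simp add: F_def)
  interpret coupling_content m \<mu> \<nu>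
  proof (intro coupling_content.intro borel_content.intro coupling_content_axioms.intro \<mu> \<nu>)
    interpret prob_space "p n" for n by (rule prob)
    show "0 \<le> m S" for S
      using lim[of S] by (rule tendsto_lowerbound) (auto simp: X_def \<open>F \<noteq> bot\<close>)
    show "m (S \<union> T) = m S + m T" if "S \<in> sets borel" "T \<in> sets borel" "S \<inter> T = {}" for S T
    proof -
      have "X n (S \<union> T) = X n S + X n T" for n
        using that couplings_sets[OF p] unfolding X_def by (intro finite_measure_Union) auto
      then have "((\<lambda>n. X n S + X n T) \<longlongrightarrow> m (S \<union> T)) F" using lim[of "S \<union> T"] by simp
      then show ?thesis using tendsto_add[OF lim lim, of S T] tendsto_unique[OF \<open>F \<noteq> bot\<close>] by blast
    qed
    show "m (A \<times> UNIV) = measure \<mu> A" if "A \<in> sets borel" for A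
    proof -
      have "X n (A \<times> UNIV) = measure \<mu> A" for n
        using couplings_emeasure(1)[OF p that] by (simp add: X_def measure_def)
      then show ?thesis using lim[of "A \<times> UNIV"] \<open>F \<noteq> bot\<close> by (simp add: tendsto_const_iff)
    qed
    show "m (UNIV \<times> B) = measure \<nu> B" if "B \<in> sets borel" for B
    proof -
      have "X n (UNIV \<times> B) = measure \<nu> B" for n
        using couplings_emeasure(2)[OF p that] by (simp add: X_def measure_def)
      then show ?thesis using lim[of "UNIV \<times> B"] \<open>F \<noteq> bot\<close> by (simp add: tendsto_const_iff)
    qed
  qed
  show thesis
    by (rule obtain_coupling) (use that[of F m] \<open>F \<noteq> bot\<close> F lim in \<open>auto simp: X_def\<close>)
qed

section \<open>Existence of optimal couplings\<close>

text \<open>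
  A discrete layer cake: \<open>staircase M t\<close> is \<open>1 / M\<close> times the number of levels \<open>j / M < t\<close> with
  \<open>1 \<le> j \<le> M\<^sup>2\<close>. Composed with a continuous cost it is a finite sum of indicators of open sets, which is
  what the inequality \<open>\<pi> U \<le> m U\<close> for open sets can handle. A finite sum also passes to the limit along
  an arbitrary filter, where Fatou's lemma may fail.
\<close>

definition staircase :: "nat \<Rightarrow> real \<Rightarrow> real" where
  "staircase M t = (\<Sum>j\<in>{1..M * M}. indicator {real j / real M<..} t / real M)"

lemma staircase_eq: "staircase M t = real (card {j\<in>{1..M * M}. real j / real M < t}) / real M"
proof -
  have "staircase M t = (\<Sum>j\<in>{1..M * M}. if real j / real M < t then 1 else 0) / real M"
    unfolding staircase_def sum_divide_distrib by (intro sum.cong) (auto simp: indicator_def)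
  then show ?thesis by (simp add: sum.If_cases Int_def)
qed

lemma staircase_le:
  assumes "0 \<le> t" shows "staircase M t \<le> t"
proof (cases "M = 0")
  case False
  have "{j\<in>{1..M * M}. real j / real M < t} \<subseteq> {1..nat \<lfloor>M * t\<rfloor>}"
    using False by (auto simp: field_simps le_nat_floor)
  then have "card {j\<in>{1..M * M}. real j / real M < t} \<le> nat \<lfloor>M * t\<rfloor>"
    by (metis card_atLeastAtMost card_mono diff_Suc_1 finite_atLeastAtMost)
  also have "real (nat \<lfloor>M * t\<rfloor>) \<le> M * t" using assms by simp
  finally show ?thesis using False by (simp add: staircase_eq field_simps)
qed (use assms in \<open>simp add: staircase_def\<close>)

lemma staircase_ge:
  assumes "0 \<le> t" "t \<le> real M" "0 < M" shows "t - 1 / real M \<le> staircase M t"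
proof -
  have "{1..nat \<lceil>M * t\<rceil> - 1} \<subseteq> {j\<in>{1..M * M}. real j / real M < t}"
  proof
    fix j assume j: "j \<in> {1..nat \<lceil>M * t\<rceil> - 1}"
    then have "j < nat \<lceil>M * t\<rceil>" by auto
    then have lt: "real j < M * t" by linarith
    also have "\<dots> \<le> M * M" using assms by (simp add: mult_left_mono)
    finally have "real j < real (M * M)" by simp
    then have "j \<le> M * M" by (simp only: of_nat_less_iff less_imp_le)
    moreover have "real j / real M < t" using lt assms(3) by (simp add: pos_divide_less_eq mult.commute)
    ultimately show "j \<in> {j\<in>{1..M * M}. real j / real M < t}" using j by simp
  qed
  then have "card {1..nat \<lceil>M * t\<rceil> - 1} \<le> card {j\<in>{1..M * M}. real j / real M < t}"
    by (intro card_mono) simp_all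
  then have "nat \<lceil>M * t\<rceil> - 1 \<le> card {j\<in>{1..M * M}. real j / real M < t}" by simp
  then have "M * t - 1 \<le> real (card {j\<in>{1..M * M}. real j / real M < t})" by linarith
  then have "(M * t - 1) / M \<le> staircase M t"
    unfolding staircase_eq by (rule divide_right_mono) simp
  moreover have "(M * t - 1) / M = t - 1 / real M" using assms(3) by (simp add: field_simps)
  ultimately show ?thesis by simp
qed

lemma staircase_tendsto:
  assumes "0 \<le> t" shows "(\<lambda>M. staircase M t) \<longlonglongrightarrow> t"
proof (rule tendsto_sandwich)
  have "(\<lambda>M. t - 1 / real M) \<longlonglongrightarrow> t - 0" by (intro tendsto_diff tendsto_const lim_1_over_n)
  then show "(\<lambda>M. t - 1 / real M) \<longlonglongrightarrow> t" by simp
  show "eventually (\<lambda>M. t - 1 / real M \<le> staircase M t) sequentially"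
    using eventually_ge_at_top[of "Suc (nat \<lceil>t\<rceil>)"]
  proof eventually_elim
    case (elim M)
    then have "t \<le> real M" "0 < M" by linarith+
    then show ?case by (rule staircase_ge[OF assms])
  qed
qed (use staircase_le[OF assms] in auto)

lemma nn_integral_staircase:
  assumes [measurable]: "c \<in> borel_measurable \<pi>" and "finite_measure \<pi>"
  shows "(\<integral>\<^sup>+z. ennreal (staircase M (c z)) \<partial>\<pi>)
    = ennreal (\<Sum>j\<in>{1..M * M}. measure \<pi> {z\<in>space \<pi>. real j / real M < c z} / real M)"
proof -
  interpret finite_measure \<pi> by fact
  have "(\<integral>\<^sup>+z. ennreal (staircase M (c z)) \<partial>\<pi>)
      = (\<integral>\<^sup>+z. (\<Sum>j\<in>{1..M * M}. ennreal (1 / real M) * indicator {z\<in>space \<pi>. real j / real M < c z} z) \<partial>\<pi>)"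
  proof (rule nn_integral_cong)
    fix z assume z: "z \<in> space \<pi>"
    have "ennreal (staircase M (c z)) = (\<Sum>j\<in>{1..M * M}. ennreal (indicator {real j / real M<..} (c z) / real M))"
      unfolding staircase_def by (rule sum_ennreal[symmetric]) simp
    also have "\<dots> = (\<Sum>j\<in>{1..M * M}. ennreal (1 / real M) * indicator {z\<in>space \<pi>. real j / real M < c z} z)"
      using z by (intro sum.cong refl) (simp split: split_indicator)
    finally show "ennreal (staircase M (c z)) = \<dots>" .
  qed
  also have "\<dots> = (\<Sum>j\<in>{1..M * M}. ennreal (1 / real M) * emeasure \<pi> {z\<in>space \<pi>. real j / real M < c z})"
    by (subst nn_integral_sum) (auto simp: nn_integral_cmult)
  also have "\<dots> = ennreal (\<Sum>j\<in>{1..M * M}. measure \<pi> {z\<in>space \<pi>. real j / real M < c z} / real M)"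
    by (subst sum_ennreal[symmetric]) (auto simp: emeasure_eq_measure ennreal_mult'[symmetric] intro!: sum.cong)
  finally show ?thesis .
qed

text \<open>
  The direct method. Along a minimizing sequence the staircase sums of the cost are at most the cost,
  and they pass to the limit coupling by the open-set inequality. Fatou's lemma in the height \<open>M\<close> of the
  staircase then bounds the cost of the limit coupling by the infimum.
\<close>

theorem optimal_coupling_exists:
  fixes \<mu> :: "'a::polish_space measure" and \<nu> :: "'b::polish_space measure" and c :: "'a \<times> 'b \<Rightarrow> real"
  assumes \<mu>: "prob_space \<mu>" "sets \<mu> = sets borel" and \<nu>: "prob_space \<nu>" "sets \<nu> = sets borel"
    and c: "continuous_on UNIV c" "\<And>z. 0 \<le> c z"
  obtains \<pi> where "\<pi> \<in> couplings \<mu> \<nu>"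
    "\<And>\<pi>'. \<pi>' \<in> couplings \<mu> \<nu> \<Longrightarrow> (\<integral>\<^sup>+z. c z \<partial>\<pi>) \<le> (\<integral>\<^sup>+z. c z \<partial>\<pi>')"
proof -
  define cost where "cost \<pi> = (\<integral>\<^sup>+z. ennreal (c z) \<partial>\<pi>)" for \<pi>
  have op: "open {z. t < c z}" for t using c(1) by (intro open_Collect_less) auto
  have cb: "c \<in> borel_measurable borel" using c(1) by (rule borel_measurable_continuous_onI)
  have meas: "c \<in> borel_measurable \<pi>" if "\<pi> \<in> couplings \<mu> \<nu>" for \<pi>
    using cb by (simp add: measurable_cong_sets[OF couplings_sets[OF that] refl])
  have "cost ` couplings \<mu> \<nu> \<noteq> {}" using couplings_nonempty[OF \<mu> \<nu>] by auto
  then obtain f where f: "decseq f" "range f \<subseteq> cost ` couplings \<mu> \<nu>" "Inf (cost ` couplings \<mu> \<nu>) = (INF i. f i)"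
    by (elim ennreal_Inf_countable_INF[THEN exE] conjE) (rule that)
  have "\<forall>n. \<exists>\<pi>. \<pi> \<in> couplings \<mu> \<nu> \<and> cost \<pi> = f n"
  proof
    fix n
    have "f n \<in> cost ` couplings \<mu> \<nu>" using f(2) by (rule range_subsetD)
    then show "\<exists>\<pi>. \<pi> \<in> couplings \<mu> \<nu> \<and> cost \<pi> = f n" by (elim imageE) (simp, fast)
  qed
  then obtain p where p: "\<And>n. p n \<in> couplings \<mu> \<nu>" "\<And>n. cost (p n) = f n"
    unfolding choice_iff using that by blast
  define v where "v = Inf (cost ` couplings \<mu> \<nu>)"
  have fv: "f \<longlonglongrightarrow> v" unfolding v_def f(3) by (rule LIMSEQ_INF[OF f(1)])
  obtain F m \<pi> where F: "F \<noteq> bot" "F \<le> sequentially" "\<And>S. ((\<lambda>n. measure (p n) S) \<longlongrightarrow> m S) F"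
    and \<pi>: "\<pi> \<in> couplings \<mu> \<nu>" "\<And>U. open U \<Longrightarrow> measure \<pi> U \<le> m U"
    by (rule couplings_cluster[where p = p, OF \<mu> \<nu> p(1)]) (rule that)
  have fin: "finite_measure \<rho>" if "\<rho> \<in> couplings \<mu> \<nu>" for \<rho>
    using couplings_prob_space[OF that \<mu>(1)] by (simp add: prob_space_def)
  have stair: "(\<integral>\<^sup>+z. ennreal (staircase M (c z)) \<partial>\<rho>)
      = ennreal (\<Sum>j\<in>{1..M * M}. measure \<rho> {z. real j / real M < c z} / real M)" if "\<rho> \<in> couplings \<mu> \<nu>" for \<rho> M
    using nn_integral_staircase[OF meas[OF that] fin[OF that], of M] couplings_space[OF that] by simp
  have le: "(\<integral>\<^sup>+z. ennreal (staircase M (c z)) \<partial>\<pi>) \<le> v" for M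
  proof -
    have "(\<integral>\<^sup>+z. ennreal (staircase M (c z)) \<partial>\<pi>) \<le> ennreal (\<Sum>j\<in>{1..M * M}. m {z. real j / real M < c z} / real M)"
      unfolding stair[OF \<pi>(1)] by (intro ennreal_leI sum_mono divide_right_mono \<pi>(2) op) auto
    also have "\<dots> \<le> v"
    proof (rule tendsto_le[OF F(1)])
      show "(f \<longlongrightarrow> v) F" using fv F(2) by (rule tendsto_mono[rotated])
      show "((\<lambda>n. \<integral>\<^sup>+z. ennreal (staircase M (c z)) \<partial>p n) \<longlongrightarrow> ennreal (\<Sum>j\<in>{1..M * M}. m {z. real j / real M < c z} / real M)) F"
        unfolding stair[OF p(1)] divide_inverse
        by (intro tendsto_ennrealI tendsto_sum tendsto_mult_right F(3))
      show "\<forall>\<^sub>F n in F. (\<integral>\<^sup>+z. ennreal (staircase M (c z)) \<partial>p n) \<le> f n"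
        unfolding p(2)[symmetric] cost_def
        by (intro always_eventually allI nn_integral_mono ennreal_leI staircase_le c)
    qed
    finally show ?thesis .
  qed
  have "cost \<pi> = (\<integral>\<^sup>+z. liminf (\<lambda>M. ennreal (staircase M (c z))) \<partial>\<pi>)"
    unfolding cost_def
    using lim_imp_Liminf[OF sequentially_bot tendsto_ennrealI[OF staircase_tendsto[OF c(2)]]] by simp
  also have "\<dots> \<le> liminf (\<lambda>M. \<integral>\<^sup>+z. ennreal (staircase M (c z)) \<partial>\<pi>)"
  proof (rule nn_integral_liminf)
    have [measurable]: "c \<in> borel_measurable \<pi>" by (rule meas) fact
    show "(\<lambda>z. ennreal (staircase M (c z))) \<in> borel_measurable \<pi>" for M
      unfolding staircase_def by measurable
  qed
  also have "\<dots> \<le> v" using le by (intro Liminf_le) auto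
  finally have "cost \<pi> \<le> v" .
  then show thesis
    using that[OF \<pi>(1)] unfolding v_def cost_def by (metis (no_types, lifting) INF_lower order.trans)
qed

section \<open>Optimal couplings have cyclically monotone support\<close>

definition sum_measures :: "'a measure \<Rightarrow> 'i set \<Rightarrow> ('i \<Rightarrow> 'a measure) \<Rightarrow> 'a measure" where
  "sum_measures N I M = measure_of (space N) (sets N) (\<lambda>A. \<Sum>i\<in>I. emeasure (M i) A)"

lemma sets_sum_measures [simp, measurable_cong]: "sets (sum_measures N I M) = sets N"
  by (simp add: sum_measures_def)

lemma space_sum_measures [simp]: "space (sum_measures N I M) = space N"
  by (simp add: sum_measures_def)

lemma emeasure_sum_measures:
  fixes N :: "'a measure"
  assumes "\<And>i. i \<in> I \<Longrightarrow> sets (M i) = sets N" "A \<in> sets N"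
  shows "emeasure (sum_measures N I M) A = (\<Sum>i\<in>I. emeasure (M i) A)"
  unfolding sum_measures_def
proof (rule emeasure_measure_of_sigma)
  show "sigma_algebra (space N) (sets N)" by (rule sets.sigma_algebra_axioms)
  show "positive (sets N) (\<lambda>A. \<Sum>i\<in>I. emeasure (M i) A)" by (simp add: positive_def)
  show "countably_additive (sets N) (\<lambda>A. \<Sum>i\<in>I. emeasure (M i) A)"
  proof (rule countably_additiveI)
    fix A :: "nat \<Rightarrow> 'a set"
    assume A: "range A \<subseteq> sets N" "disjoint_family A"
    have "(\<Sum>n. \<Sum>i\<in>I. emeasure (M i) (A n)) = (\<Sum>i\<in>I. \<Sum>n. emeasure (M i) (A n))"
      by (rule suminf_sum) simp
    also have "\<dots> = (\<Sum>i\<in>I. emeasure (M i) (\<Union>n. A n))"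
      using A assms(1) by (intro sum.cong refl suminf_emeasure) simp_all
    finally show "(\<Sum>n. \<Sum>i\<in>I. emeasure (M i) (A n)) = (\<Sum>i\<in>I. emeasure (M i) (\<Union>n. A n))" .
  qed
qed (rule assms)

lemma nn_integral_sum_measures:
  fixes N :: "'a measure"
  assumes s: "\<And>i. i \<in> I \<Longrightarrow> sets (M i) = sets N" and f: "f \<in> borel_measurable N"
  shows "nn_integral (sum_measures N I M) f = (\<Sum>i\<in>I. nn_integral (M i) f)"
  using f
proof induction
  have sp: "i \<in> I \<Longrightarrow> space (M i) = space N" for i using sets_eq_imp_space_eq[OF s] .
  have m: "i \<in> I \<Longrightarrow> g \<in> borel_measurable N \<Longrightarrow> g \<in> borel_measurable (M i)" for i and g :: "'a \<Rightarrow> ennreal"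
    by (simp add: measurable_cong_sets[OF s refl])
  {
    case (cong f g)
    then have "nn_integral (sum_measures N I M) f = nn_integral (sum_measures N I M) g"
      by (intro nn_integral_cong) simp
    moreover have "(\<Sum>i\<in>I. nn_integral (M i) f) = (\<Sum>i\<in>I. nn_integral (M i) g)"
      using cong sp by (intro sum.cong refl nn_integral_cong) simp
    ultimately show ?case using cong by simp
  next
    case (set A)
    then show ?case using s by (simp add: emeasure_sum_measures[OF s])
  next
    case (mult f c)
    then show ?case using m by (simp add: nn_integral_cmult sum_distrib_left)
  next
    case (add f g)
    then show ?case using m by (simp add: nn_integral_add sum.distrib)
  next
    case (seq U)
    have meas: "U n \<in> borel_measurable (sum_measures N I M)" for n
      using seq.hyps(1)[of n] by (simp add: measurable_cong_sets[OF sets_sum_measures refl])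
    have sup: "(SUP n. U n) = (\<lambda>x. SUP n. U n x)" by (simp add: fun_eq_iff image_comp)
    have "nn_integral (sum_measures N I M) (SUP n. U n) = (SUP n. nn_integral (sum_measures N I M) (U n))"
      unfolding sup by (rule nn_integral_monotone_convergence_SUP[OF \<open>incseq U\<close> meas])
    also have "\<dots> = (SUP n. \<Sum>i\<in>I. nn_integral (M i) (U n))" by (simp add: seq.IH)
    also have "\<dots> = (\<Sum>i\<in>I. SUP n. nn_integral (M i) (U n))"
    proof (rule ennreal_SUP_sum)
      show "mono (\<lambda>n. nn_integral (M i) (U n))" if "i \<in> I" for i
        using \<open>incseq U\<close> by (intro monoI nn_integral_mono) (simp add: incseq_def le_fun_def)
    qed
    also have "\<dots> = (\<Sum>i\<in>I. nn_integral (M i) (SUP n. U n))"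
      unfolding sup
      by (intro sum.cong refl nn_integral_monotone_convergence_SUP[symmetric] \<open>incseq U\<close> m seq.hyps(1))
    finally show ?case .
  }
qed

text \<open>
  Removes a small multiple of \<open>\<pi>\<close> conditioned on each \<open>W i\<close> and adds the same multiple of \<open>Q i\<close>. The
  resulting measure is described by a balance equation in which the removed part is added on the other
  side, because subtraction is not well behaved in \<^typ>\<open>ennreal\<close>.
\<close>

lemma exchange_measure_exists:
  fixes \<pi> :: "'z measure" and W :: "nat \<Rightarrow> 'z set" and k :: nat
  assumes fin: "finite_measure \<pi>"
    and W: "\<And>i. i < k \<Longrightarrow> W i \<in> sets \<pi>" "\<And>i. i < k \<Longrightarrow> 0 < measure \<pi> (W i)"
    and Q: "\<And>i. i < k \<Longrightarrow> sets (Q i) = sets \<pi>"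
  obtains \<epsilon> :: real and \<pi>' where "0 < \<epsilon>" "sets \<pi>' = sets \<pi>"
    "\<And>f. f \<in> borel_measurable \<pi> \<Longrightarrow>
       nn_integral \<pi>' f + ennreal \<epsilon> * (\<Sum>i<k. nn_integral (uniform_measure \<pi> (W i)) f)
       = nn_integral \<pi> f + ennreal \<epsilon> * (\<Sum>i<k. nn_integral (Q i) f)"
proof -
  interpret finite_measure \<pi> by fact
  define p where "p i = measure \<pi> (W i)" for i
  have p: "0 < p i" if "i < k" for i using W(2)[OF that] by (simp add: p_def)
  have s0: "0 \<le> (\<Sum>i<k. 1 / p i)" using p by (intro sum_nonneg) (simp add: less_imp_le)
  \<comment> \<open>Small enough for the removed density \<open>g\<close> not to exceed \<open>1\<close>, even where the sets \<open>W i\<close> overlap.\<close>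
  define \<epsilon> where "\<epsilon> = 1 / (1 + (\<Sum>i<k. 1 / p i))"
  have \<epsilon>: "0 < \<epsilon>" using s0 by (simp add: \<epsilon>_def)
  define g where "g z = (\<Sum>i<k. \<epsilon> / p i * indicator (W i) z)" for z
  have g0: "0 \<le> g z" for z
    unfolding g_def using p \<epsilon> by (intro sum_nonneg) (simp add: less_imp_le)
  have g1: "g z \<le> 1" for z
  proof -
    have "g z \<le> (\<Sum>i<k. \<epsilon> * (1 / p i))"
      unfolding g_def using p \<epsilon> by (intro sum_mono) (auto simp: indicator_def less_imp_le)
    also have "\<dots> = \<epsilon> * (\<Sum>i<k. 1 / p i)" by (rule sum_distrib_left[symmetric])
    also have "\<dots> \<le> 1" using s0 by (simp add: \<epsilon>_def field_simps)
    finally show ?thesis .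
  qed
  have gm [measurable]: "g \<in> borel_measurable \<pi>"
    unfolding g_def using W(1) by (intro borel_measurable_sum borel_measurable_times borel_measurable_const borel_measurable_indicator) simp_all
  define \<delta> where "\<delta> = density \<pi> (\<lambda>z. ennreal (1 - g z))"
  define N where "N i = (if i < k then scale_measure (ennreal \<epsilon>) (Q i) else \<delta>)" for i
  define \<pi>' where "\<pi>' = sum_measures \<pi> {..<Suc k} N"
  have sN: "sets (N i) = sets \<pi>" for i using Q by (simp add: N_def \<delta>_def)
  have split: "nn_integral \<delta> f + ennreal \<epsilon> * (\<Sum>i<k. nn_integral (uniform_measure \<pi> (W i)) f) = nn_integral \<pi> f"
    if f [measurable]: "f \<in> borel_measurable \<pi>" for f
  proof -
    have u: "ennreal \<epsilon> * nn_integral (uniform_measure \<pi> (W i)) f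
        = (\<integral>\<^sup>+z. ennreal (\<epsilon> / p i * indicator (W i) z) * f z \<partial>\<pi>)" if i: "i < k" for i
    proof -
      have [measurable]: "W i \<in> sets \<pi>" using W(1)[OF i] .
      have "ennreal \<epsilon> * nn_integral (uniform_measure \<pi> (W i)) f
          = ennreal \<epsilon> * ((\<integral>\<^sup>+z. f z * indicator (W i) z \<partial>\<pi>) / ennreal (p i))"
        by (simp add: nn_integral_uniform_measure p_def emeasure_eq_measure)
      also have "\<dots> = ennreal (\<epsilon> / p i) * (\<integral>\<^sup>+z. f z * indicator (W i) z \<partial>\<pi>)"
        using p[OF i] \<epsilon>
        by (simp add: divide_ennreal_def ennreal_mult' inverse_ennreal mult_ac divide_inverse)
      also have "\<dots> = (\<integral>\<^sup>+z. ennreal (\<epsilon> / p i) * (f z * indicator (W i) z) \<partial>\<pi>)"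
        by (rule nn_integral_cmult[symmetric]) measurable
      also have "\<dots> = (\<integral>\<^sup>+z. ennreal (\<epsilon> / p i * indicator (W i) z) * f z \<partial>\<pi>)"
        by (intro nn_integral_cong) (simp split: split_indicator)
      finally show ?thesis .
    qed
    have "ennreal \<epsilon> * (\<Sum>i<k. nn_integral (uniform_measure \<pi> (W i)) f)
        = (\<Sum>i<k. \<integral>\<^sup>+z. ennreal (\<epsilon> / p i * indicator (W i) z) * f z \<partial>\<pi>)"
      unfolding sum_distrib_left by (intro sum.cong refl u) simp
    also have "\<dots> = (\<integral>\<^sup>+z. (\<Sum>i<k. ennreal (\<epsilon> / p i * indicator (W i) z) * f z) \<partial>\<pi>)"
    proof (rule nn_integral_sum[symmetric])
      fix i assume "i \<in> {..<k}"
      then have [measurable]: "W i \<in> sets \<pi>" using W(1) by simp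
      show "(\<lambda>z. ennreal (\<epsilon> / p i * indicator (W i) z) * f z) \<in> borel_measurable \<pi>" by measurable
    qed
    also have "\<dots> = (\<integral>\<^sup>+z. ennreal (g z) * f z \<partial>\<pi>)"
    proof (rule nn_integral_cong)
      fix z
      have "ennreal (g z) = (\<Sum>i<k. ennreal (\<epsilon> / p i * indicator (W i) z))"
        unfolding g_def using p \<epsilon> by (intro sum_ennreal[symmetric]) (simp add: less_imp_le)
      then show "(\<Sum>i<k. ennreal (\<epsilon> / p i * indicator (W i) z) * f z) = ennreal (g z) * f z"
        by (simp add: sum_distrib_right)
    qed
    finally have "nn_integral \<delta> f + ennreal \<epsilon> * (\<Sum>i<k. nn_integral (uniform_measure \<pi> (W i)) f)
        = (\<integral>\<^sup>+z. ennreal (1 - g z) * f z \<partial>\<pi>) + (\<integral>\<^sup>+z. ennreal (g z) * f z \<partial>\<pi>)"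
      unfolding \<delta>_def by (simp add: nn_integral_density)
    also have "\<dots> = (\<integral>\<^sup>+z. ennreal (1 - g z) * f z + ennreal (g z) * f z \<partial>\<pi>)"
      by (rule nn_integral_add[symmetric]) measurable
    also have "\<dots> = nn_integral \<pi> f"
    proof (rule nn_integral_cong)
      fix z
      have "ennreal (1 - g z) + ennreal (g z) = 1"
        using g0[of z] g1[of z] by (simp flip: ennreal_plus)
      then show "ennreal (1 - g z) * f z + ennreal (g z) * f z = f z"
        by (simp flip: distrib_right)
    qed
    finally show ?thesis .
  qed
  show thesis
  proof (rule that[OF \<epsilon>, of \<pi>'])
    show "sets \<pi>' = sets \<pi>" by (simp add: \<pi>'_def)
    fix f :: "'z \<Rightarrow> ennreal" assume f: "f \<in> borel_measurable \<pi>"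
    have "nn_integral \<pi>' f = (\<Sum>i<Suc k. nn_integral (N i) f)"
      unfolding \<pi>'_def by (intro nn_integral_sum_measures sN f)
    also have "\<dots> = (\<Sum>i<k. nn_integral (N i) f) + nn_integral \<delta> f" by (simp add: N_def)
    also have "(\<Sum>i<k. nn_integral (N i) f) = (\<Sum>i<k. ennreal \<epsilon> * nn_integral (Q i) f)"
    proof (intro sum.cong refl)
      fix i assume "i \<in> {..<k}"
      then have i: "i < k" by simp
      have "f \<in> borel_measurable (Q i)" using f by (simp add: measurable_cong_sets[OF Q[OF i] refl])
      then show "nn_integral (N i) f = ennreal \<epsilon> * nn_integral (Q i) f"
        using i by (simp add: N_def nn_integral_scale_measure)
    qed
    finally have "nn_integral \<pi>' f = ennreal \<epsilon> * (\<Sum>i<k. nn_integral (Q i) f) + nn_integral \<delta> f"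
      by (simp add: sum_distrib_left)
    then have "nn_integral \<pi>' f + ennreal \<epsilon> * (\<Sum>i<k. nn_integral (uniform_measure \<pi> (W i)) f)
       = ennreal \<epsilon> * (\<Sum>i<k. nn_integral (Q i) f)
         + (nn_integral \<delta> f + ennreal \<epsilon> * (\<Sum>i<k. nn_integral (uniform_measure \<pi> (W i)) f))"
      by (simp only: add.assoc)
    then show "nn_integral \<pi>' f + ennreal \<epsilon> * (\<Sum>i<k. nn_integral (uniform_measure \<pi> (W i)) f)
       = nn_integral \<pi> f + ennreal \<epsilon> * (\<Sum>i<k. nn_integral (Q i) f)"
      unfolding split[OF f] by (simp only: add.commute)
  qed
qed

lemma sum_cyclic_shift:
  fixes f :: "nat \<Rightarrow> 'a::comm_monoid_add"
  assumes "f k = f 0"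
  shows "(\<Sum>i<k. f (Suc i)) = (\<Sum>i<k. f i)"
proof (cases k)
  case (Suc l)
  then show ?thesis using assms sum.lessThan_Suc_shift[of f l] by (simp add: add.commute)
qed simp

lemma prob_space_nn_integral_le:
  assumes "prob_space M" "AE x in M. f x \<le> ennreal C"
  shows "nn_integral M f \<le> ennreal C"
proof -
  interpret prob_space M by fact
  have "nn_integral M f \<le> (\<integral>\<^sup>+x. ennreal C \<partial>M)" using assms(2) by (rule nn_integral_mono_AE)
  then show ?thesis by (simp add: emeasure_space_1)
qed

lemma prob_space_nn_integral_ge:
  assumes "prob_space M" "AE x in M. ennreal C \<le> f x"
  shows "ennreal C \<le> nn_integral M f"
proof -
  interpret prob_space M by fact
  have "(\<integral>\<^sup>+x. ennreal C \<partial>M) \<le> nn_integral M f" using assms(2) by (rule nn_integral_mono_AE)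
  then show ?thesis by (simp add: emeasure_space_1)
qed

text \<open>
  The condition \<open>z k = z 0\<close> closes the cycle, so that \<open>Suc i\<close> needs no reduction modulo \<open>k\<close>.
\<close>

definition cyclically_monotone :: "('a \<times> 'b \<Rightarrow> real) \<Rightarrow> ('a \<times> 'b) set \<Rightarrow> bool" where
  "cyclically_monotone c \<Gamma> \<longleftrightarrow>
     (\<forall>k z. (\<forall>i<k. z i \<in> \<Gamma>) \<longrightarrow> z k = z 0 \<longrightarrow> (\<Sum>i<k. c (z i)) \<le> (\<Sum>i<k. c (fst (z (Suc i)), snd (z i))))"

definition support :: "'a::topological_space measure \<Rightarrow> 'a set" where
  "support \<pi> = {z. \<forall>U. open U \<longrightarrow> z \<in> U \<longrightarrow> 0 < emeasure \<pi> U}"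

text \<open>
  The complement of the support is a union of null open sets. Members of a countable basis suffice.
\<close>

lemma AE_support:
  fixes \<pi> :: "'a::second_countable_topology measure"
  assumes s: "sets \<pi> = sets borel"
  shows "AE z in \<pi>. z \<in> support \<pi>"
proof -
  obtain \<B> :: "'a set set" where \<B>: "countable \<B>" "topological_basis \<B>"
    using ex_countable_basis by blast
  have "AE z in \<pi>. \<forall>B\<in>\<B>. emeasure \<pi> B = 0 \<longrightarrow> z \<notin> B"
  proof (rule AE_ball_countable'[OF _ \<B>(1)])
    fix B assume "B \<in> \<B>"
    then have "B \<in> sets \<pi>" using topological_basis_open[OF \<B>(2)] s by simp
    then show "AE z in \<pi>. emeasure \<pi> B = 0 \<longrightarrow> z \<notin> B"
      by (cases "emeasure \<pi> B = 0") (simp_all add: AE_not_in null_setsI)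
  qed
  then show ?thesis
  proof eventually_elim
    case (elim z)
    show ?case unfolding support_def
    proof (intro CollectI allI impI)
      fix U :: "'a set" assume U: "open U" "z \<in> U"
      then obtain B where B: "B \<in> \<B>" "z \<in> B" "B \<subseteq> U" by (rule topological_basisE[OF \<B>(2)])
      then have "emeasure \<pi> B \<noteq> 0" using elim by blast
      moreover have "emeasure \<pi> B \<le> emeasure \<pi> U" using B(3) U(1) s by (intro emeasure_mono) simp_all
      ultimately show "0 < emeasure \<pi> U" by (metis le_zero_eq not_gr_zero)
    qed
  qed
qed

text \<open>
  Suppose that a cycle of points \<open>z i\<close> of the support becomes cheaper by matching the first component of
  \<open>z (Suc i)\<close> with the second component of \<open>z i\<close>. By continuity, the same holds for all points of small
  boxes \<open>W i\<close> around the \<open>z i\<close>, and these boxes have positive mass. Let \<open>\<alpha> i\<close> and \<open>\<beta> i\<close> be the marginals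
  of \<open>\<pi>\<close> conditioned on \<open>W i\<close>. Exchanging a little of the conditioned measures for the products
  \<open>\<alpha> (Suc i) \<Otimes>\<^sub>M \<beta> i\<close> keeps both marginals, since shifting the index along a cycle does not change a sum,
  but lowers the cost, contradicting optimality.
\<close>

theorem optimal_coupling_cyclically_monotone:
  fixes \<mu> :: "'a::polish_space measure" and \<nu> :: "'b::polish_space measure" and c :: "'a \<times> 'b \<Rightarrow> real"
  assumes \<mu>: "prob_space \<mu>" "sets \<mu> = sets borel" and \<nu>: "prob_space \<nu>" "sets \<nu> = sets borel"
    and c: "continuous_on UNIV c" "\<And>z. 0 \<le> c z"
    and \<pi>: "\<pi> \<in> couplings \<mu> \<nu>" "(\<integral>\<^sup>+z. c z \<partial>\<pi>) < \<infinity>"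
    and opt: "\<And>\<pi>'. \<pi>' \<in> couplings \<mu> \<nu> \<Longrightarrow> (\<integral>\<^sup>+z. c z \<partial>\<pi>) \<le> (\<integral>\<^sup>+z. c z \<partial>\<pi>')"
  shows "cyclically_monotone c (support \<pi>)"
  unfolding cyclically_monotone_def
proof (intro allI impI, rule ccontr)
  fix k z assume z: "\<forall>i<k. z i \<in> support \<pi>" "z k = z 0"
    and neg: "\<not> (\<Sum>i<k. c (z i)) \<le> (\<Sum>i<k. c (fst (z (Suc i)), snd (z i)))"
  interpret \<pi>: prob_space \<pi> by (rule couplings_prob_space[OF \<pi>(1) \<mu>(1)])
  note sets_\<pi> = couplings_sets[OF \<pi>(1)]
  define z' where "z' i = (fst (z (Suc i)), snd (z i))" for i
  \<comment> \<open>An error of \<open>\<eta>\<close> in each of the \<open>2 * k\<close> terms uses up only two thirds of the gain.\<close>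
  define \<eta> where "\<eta> = ((\<Sum>i<k. c (z i)) - (\<Sum>i<k. c (z' i))) / (3 * k)"
  have k: "0 < k" using neg by (cases k) simp_all
  have \<eta>: "0 < \<eta>" using neg k by (simp add: \<eta>_def z'_def)
  have gap: "(\<Sum>i<k. c (z' i) + \<eta>) < (\<Sum>i<k. c (z i) - \<eta>)"
  proof -
    have "(\<Sum>i<k. c (z i)) - (\<Sum>i<k. c (z' i)) = 3 * (k * \<eta>)" using k by (simp add: \<eta>_def)
    moreover have "0 < k * \<eta>" using k \<eta> by simp
    moreover have "(\<Sum>i<k. c (z' i) + \<eta>) = (\<Sum>i<k. c (z' i)) + k * \<eta>"
      "(\<Sum>i<k. c (z i) - \<eta>) = (\<Sum>i<k. c (z i)) - k * \<eta>"
      by (simp_all add: sum.distrib sum_subtractf)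
    ultimately show ?thesis by linarith
  qed
  have near: "\<exists>r>0. \<forall>a\<in>ball (fst w) r. \<forall>b\<in>ball (snd w) r. \<bar>c (a, b) - c w\<bar> < \<eta>" for w
  proof -
    have "open (c -` ball (c w) \<eta>)" by (rule open_vimage[OF open_ball c(1)])
    moreover have "(fst w, snd w) \<in> c -` ball (c w) \<eta>" using \<eta> by simp
    ultimately obtain A B where AB: "open A" "open B" "fst w \<in> A" "snd w \<in> B" "A \<times> B \<subseteq> c -` ball (c w) \<eta>"
      by (metis open_prod_elim mem_Sigma_iff)
    obtain r1 where r1: "0 < r1" "ball (fst w) r1 \<subseteq> A" using AB by (metis open_contains_ball)
    obtain r2 where r2: "0 < r2" "ball (snd w) r2 \<subseteq> B" using AB by (metis open_contains_ball)
    have "\<bar>c (a, b) - c w\<bar> < \<eta>" if "a \<in> ball (fst w) (min r1 r2)" "b \<in> ball (snd w) (min r1 r2)" for a b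
    proof -
      have "a \<in> A" "b \<in> B" using that r1(2) r2(2) by auto
      then have "(a, b) \<in> c -` ball (c w) \<eta>" using AB(5) by blast
      then show ?thesis by (simp add: dist_real_def abs_minus_commute)
    qed
    then show ?thesis using r1(1) r2(1) by (intro exI[of _ "min r1 r2"]) simp
  qed
  then obtain \<rho> where \<rho>: "\<And>w. 0 < \<rho> w"
    "\<And>w a b. a \<in> ball (fst w) (\<rho> w) \<Longrightarrow> b \<in> ball (snd w) (\<rho> w) \<Longrightarrow> \<bar>c (a, b) - c w\<bar> < \<eta>"
    by metis
  define r where "r = Min ((\<lambda>i. min (\<rho> (z i)) (\<rho> (z' i))) ` {..<k})"
  have r: "0 < r" unfolding r_def using k \<rho>(1) by (subst Min_gr_iff) auto
  have rle: "r \<le> \<rho> (z i)" "r \<le> \<rho> (z' i)" if "i < k" for i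
  proof -
    have "r \<le> min (\<rho> (z i)) (\<rho> (z' i))" unfolding r_def using that by (intro Min_le) auto
    then show "r \<le> \<rho> (z i)" "r \<le> \<rho> (z' i)" by simp_all
  qed
  define U where "U i = ball (fst (z i)) r" for i
  define V where "V i = ball (snd (z i)) r" for i
  define W where "W i = U i \<times> V i" for i
  have UV [measurable]: "U i \<in> sets borel" "V i \<in> sets borel" for i by (simp_all add: U_def V_def)
  have W: "W i \<in> sets \<pi>" for i unfolding W_def sets_\<pi> by (rule Times_borel[OF UV])
  have Wpos: "0 < emeasure \<pi> (W i)" if "i < k" for i
  proof -
    have "open (W i)" by (simp add: W_def U_def V_def open_Times)
    moreover have "z i \<in> W i" using r by (simp add: W_def U_def V_def mem_Times_iff)
    ultimately show ?thesis using z(1) that unfolding support_def by blast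
  qed
  have per: "U k = U 0" "V k = V 0" "W k = W 0" using z(2) by (simp_all add: U_def V_def W_def)
  have Wpos': "0 < emeasure \<pi> (W i)" if "i \<le> k" for i
    using that Wpos per(3) k by (cases "i = k") simp_all
  define \<pi>i where "\<pi>i i = uniform_measure \<pi> (W i)" for i
  define \<alpha> where "\<alpha> i = distr (\<pi>i i) borel fst" for i
  define \<beta> where "\<beta> i = distr (\<pi>i i) borel snd" for i
  define Q where "Q i = \<alpha> (Suc i) \<Otimes>\<^sub>M \<beta> i" for i
  have sets_i: "sets (\<pi>i i) = sets borel" for i by (simp add: \<pi>i_def sets_\<pi>)
  have fst_i: "fst \<in> borel_measurable (\<pi>i i)" and snd_i: "snd \<in> borel_measurable (\<pi>i i)" for i
    by (simp_all add: measurable_cong_sets[OF sets_i refl])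
  have prob_i: "prob_space (\<pi>i i)" if "i \<le> k" for i
    unfolding \<pi>i_def using Wpos'[OF that] by (intro prob_space_uniform_measure) (simp_all add: less_imp_neq[symmetric])
  have AE_i: "AE w in \<pi>i i. w \<in> W i" for i
    unfolding \<pi>i_def by (rule AE_uniform_measureI[OF W]) simp
  have prob_\<alpha>: "prob_space (\<alpha> i)" and prob_\<beta>: "prob_space (\<beta> i)" if "i \<le> k" for i
    unfolding \<alpha>_def \<beta>_def using prob_space.prob_space_distr[OF prob_i[OF that]] fst_i snd_i by auto
  have AE_\<alpha>: "AE a in \<alpha> i. a \<in> U i" for i
  proof -
    have "AE w in \<pi>i i. fst w \<in> U i" using AE_i[of i] by eventually_elim (simp add: W_def mem_Times_iff)
    then show ?thesis unfolding \<alpha>_def by (subst AE_distr_iff[OF fst_i]) simp_all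
  qed
  have AE_\<beta>: "AE b in \<beta> i. b \<in> V i" for i
  proof -
    have "AE w in \<pi>i i. snd w \<in> V i" using AE_i[of i] by eventually_elim (simp add: W_def mem_Times_iff)
    then show ?thesis unfolding \<beta>_def by (subst AE_distr_iff[OF snd_i]) simp_all
  qed
  have Qc: "Q i \<in> couplings (\<alpha> (Suc i)) (\<beta> i)" if "i < k" for i
    unfolding Q_def using that
    by (intro couplings_nonempty prob_\<alpha> prob_\<beta>) (simp_all add: \<alpha>_def \<beta>_def)
  have prob_Q: "prob_space (Q i)" if "i < k" for i
    using couplings_prob_space[OF Qc[OF that] prob_\<alpha>] that by simp
  have AE_Q: "AE w in Q i. fst w \<in> U (Suc i) \<and> snd w \<in> V i" if i: "i < k" for i
  proof -
    have "AE w in Q i. fst w \<in> U (Suc i)"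
      using AE_\<alpha>[of "Suc i"] unfolding couplings_fst[OF Qc[OF i], symmetric]
      by (rule AE_distrD[OF couplings_measurable_fst[OF Qc[OF i]]])
    moreover have "AE w in Q i. snd w \<in> V i"
      using AE_\<beta>[of i] unfolding couplings_snd[OF Qc[OF i], symmetric]
      by (rule AE_distrD[OF couplings_measurable_snd[OF Qc[OF i]]])
    ultimately show ?thesis by eventually_elim simp
  qed
  obtain \<epsilon> \<pi>' where \<epsilon>: "0 < \<epsilon>" and sets_\<pi>': "sets \<pi>' = sets \<pi>" and bal:
    "\<And>f. f \<in> borel_measurable \<pi> \<Longrightarrow>
       nn_integral \<pi>' f + ennreal \<epsilon> * (\<Sum>i<k. nn_integral (\<pi>i i) f)
       = nn_integral \<pi> f + ennreal \<epsilon> * (\<Sum>i<k. nn_integral (Q i) f)"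
  proof (rule exchange_measure_exists[of \<pi> k W Q])
    show "finite_measure \<pi>" by (rule \<pi>.finite_measure_axioms)
    show "0 < measure \<pi> (W i)" if "i < k" for i
      using Wpos[OF that] by (simp add: \<pi>.emeasure_eq_measure)
    show "sets (Q i) = sets \<pi>" if "i < k" for i using couplings_sets[OF Qc[OF that]] sets_\<pi> by simp
  qed (use W that in \<open>simp_all add: \<pi>i_def\<close>)
  have bal_set: "emeasure \<pi>' A + ennreal \<epsilon> * (\<Sum>i<k. emeasure (\<pi>i i) A)
      = emeasure \<pi> A + ennreal \<epsilon> * (\<Sum>i<k. emeasure (Q i) A)" if A: "A \<in> sets borel" for A
  proof -
    have ind: "nn_integral M (indicator A) = emeasure M A" if "sets M = sets borel" for M :: "('a \<times> 'b) measure"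
      using that A by simp
    have "(\<Sum>i<k. nn_integral (Q i) (indicator A)) = (\<Sum>i<k. emeasure (Q i) A)"
      by (intro sum.cong refl ind couplings_sets[OF Qc]) simp
    moreover have "(\<Sum>i<k. nn_integral (\<pi>i i) (indicator A)) = (\<Sum>i<k. emeasure (\<pi>i i) A)"
      by (intro sum.cong refl ind sets_i)
    moreover have "indicator A \<in> borel_measurable \<pi>"
      using A sets_\<pi> by (intro borel_measurable_indicator) simp
    ultimately show ?thesis
      using bal[of "indicator A"] ind[OF sets_\<pi>] ind[of \<pi>'] sets_\<pi> sets_\<pi>' by metis
  qed
  have cancel: "emeasure \<pi>' A = emeasure \<pi> A"
    if A: "A \<in> sets borel" and eq: "(\<Sum>i<k. emeasure (Q i) A) = (\<Sum>i<k. emeasure (\<pi>i i) A)" for A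
  proof -
    have "(\<Sum>i<k. emeasure (\<pi>i i) A) \<noteq> top"
      using prob_i by (simp add: finite_measure.emeasure_finite prob_space_def)
    then have "ennreal \<epsilon> * (\<Sum>i<k. emeasure (\<pi>i i) A) \<noteq> top" by (simp only: ennreal_mult_eq_top_iff) simp
    then show ?thesis using bal_set[OF A] unfolding eq
      by (simp add: ennreal_add_left_cancel add.commute[of _ "ennreal \<epsilon> * (\<Sum>i<k. emeasure (\<pi>i i) A)"])
  qed
  have \<alpha>_eq: "emeasure (\<pi>i i) (A \<times> UNIV) = emeasure (\<alpha> i) A" if "A \<in> sets borel" for A i
    using that emeasure_distr[OF fst_i that, of i] sets_eq_imp_space_eq[OF sets_i[of i]]
    by (simp add: \<alpha>_def vimage_fst)
  have \<beta>_eq: "emeasure (\<pi>i i) (UNIV \<times> B) = emeasure (\<beta> i) B" if "B \<in> sets borel" for B i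
    using that emeasure_distr[OF snd_i that, of i] sets_eq_imp_space_eq[OF sets_i[of i]]
    by (simp add: \<beta>_def vimage_snd)
  have "\<pi>' \<in> couplings \<mu> \<nu>"
  proof (rule couplingsI)
    show "sets \<pi>' = sets borel" by (simp add: sets_\<pi>' sets_\<pi>)
    show "emeasure \<pi>' (A \<times> UNIV) = emeasure \<mu> A" if A: "A \<in> sets borel" for A
    proof -
      have "(\<Sum>i<k. emeasure (Q i) (A \<times> UNIV)) = (\<Sum>i<k. emeasure (\<alpha> (Suc i)) A)"
        using couplings_emeasure(1)[OF Qc A] by simp
      also have "\<dots> = (\<Sum>i<k. emeasure (\<alpha> i) A)"
        by (rule sum_cyclic_shift) (simp add: \<alpha>_def \<pi>i_def per)
      finally show ?thesis
        using cancel[OF Times_UNIV_borel[OF A]] couplings_emeasure(1)[OF \<pi>(1) A] \<alpha>_eq[OF A] by simp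
    qed
    show "emeasure \<pi>' (UNIV \<times> B) = emeasure \<nu> B" if B: "B \<in> sets borel" for B
      using cancel[OF UNIV_Times_borel[OF B]] couplings_emeasure(2)[OF \<pi>(1) B]
        couplings_emeasure(2)[OF Qc B] \<beta>_eq[OF B] by simp
  qed (rule \<mu> \<nu>)+
  then have le: "(\<integral>\<^sup>+z. c z \<partial>\<pi>) \<le> (\<integral>\<^sup>+z. c z \<partial>\<pi>')" by (rule opt)
  have "c \<in> borel_measurable borel" using c(1) by (rule borel_measurable_continuous_onI)
  then have cm: "(\<lambda>z. ennreal (c z)) \<in> borel_measurable \<pi>"
    by (simp add: measurable_cong_sets[OF sets_\<pi> refl])
  have "(\<integral>\<^sup>+z. c z \<partial>\<pi>) + ennreal \<epsilon> * (\<Sum>i<k. \<integral>\<^sup>+z. c z \<partial>\<pi>i i)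
      \<le> (\<integral>\<^sup>+z. c z \<partial>\<pi>') + ennreal \<epsilon> * (\<Sum>i<k. \<integral>\<^sup>+z. c z \<partial>\<pi>i i)"
    using le by (rule add_right_mono)
  also have "\<dots> = (\<integral>\<^sup>+z. c z \<partial>\<pi>) + ennreal \<epsilon> * (\<Sum>i<k. \<integral>\<^sup>+z. c z \<partial>Q i)"
    by (rule bal[OF cm])
  finally have "ennreal \<epsilon> * (\<Sum>i<k. \<integral>\<^sup>+z. c z \<partial>\<pi>i i) \<le> ennreal \<epsilon> * (\<Sum>i<k. \<integral>\<^sup>+z. c z \<partial>Q i)"
    using less_imp_neq[OF \<pi>(2)] unfolding ennreal_add_left_cancel_le by blast
  then have AB: "(\<Sum>i<k. \<integral>\<^sup>+z. c z \<partial>\<pi>i i) \<le> (\<Sum>i<k. \<integral>\<^sup>+z. c z \<partial>Q i)"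
    using \<epsilon> by (simp add: ennreal_mult_le_mult_iff)
  have Qle: "(\<integral>\<^sup>+z. c z \<partial>Q i) \<le> ennreal (c (z' i) + \<eta>)" if i: "i < k" for i
  proof (rule prob_space_nn_integral_le[OF prob_Q[OF i]])
    show "AE w in Q i. ennreal (c w) \<le> ennreal (c (z' i) + \<eta>)"
      using AE_Q[OF i]
    proof eventually_elim
      case (elim w)
      then have "fst w \<in> ball (fst (z' i)) (\<rho> (z' i))" "snd w \<in> ball (snd (z' i)) (\<rho> (z' i))"
        using rle(2)[OF i] by (simp_all add: U_def V_def z'_def)
      from \<rho>(2)[OF this] show ?case by (intro ennreal_leI) simp
    qed
  qed
  have ile: "ennreal (c (z i) - \<eta>) \<le> (\<integral>\<^sup>+z. c z \<partial>\<pi>i i)" if i: "i < k" for i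
  proof (rule prob_space_nn_integral_ge[OF prob_i[OF less_imp_le[OF i]]])
    show "AE w in \<pi>i i. ennreal (c (z i) - \<eta>) \<le> ennreal (c w)"
      using AE_i[of i]
    proof eventually_elim
      case (elim w)
      then have "fst w \<in> ball (fst (z i)) (\<rho> (z i))" "snd w \<in> ball (snd (z i)) (\<rho> (z i))"
        using rle(1)[OF i] by (simp_all add: U_def V_def W_def mem_Times_iff)
      from \<rho>(2)[OF this] show ?case by (intro ennreal_leI) simp
    qed
  qed
  have "ennreal (\<Sum>i<k. c (z i) - \<eta>) \<le> ennreal (\<Sum>i<k. max 0 (c (z i) - \<eta>))"
    by (intro ennreal_leI sum_mono) simp
  also have "\<dots> = (\<Sum>i<k. ennreal (max 0 (c (z i) - \<eta>)))" by (rule sum_ennreal[symmetric]) simp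
  also have "\<dots> = (\<Sum>i<k. ennreal (c (z i) - \<eta>))"
    by (intro sum.cong refl) (simp add: max_def ennreal_neg)
  also have "\<dots> \<le> (\<Sum>i<k. \<integral>\<^sup>+z. c z \<partial>\<pi>i i)" by (intro sum_mono ile) simp
  also have "\<dots> \<le> (\<Sum>i<k. \<integral>\<^sup>+z. c z \<partial>Q i)" by (rule AB)
  also have "\<dots> \<le> (\<Sum>i<k. ennreal (c (z' i) + \<eta>))" by (intro sum_mono Qle) simp
  also have "\<dots> = ennreal (\<Sum>i<k. c (z' i) + \<eta>)" using c(2) \<eta> by (intro sum_ennreal) (simp add: add_nonneg_nonneg less_imp_le)
  finally have "ennreal (\<Sum>i<k. c (z i) - \<eta>) \<le> ennreal (\<Sum>i<k. c (z' i) + \<eta>)" .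
  moreover have "0 \<le> (\<Sum>i<k. c (z' i) + \<eta>)"
    using c(2) \<eta> by (intro sum_nonneg add_nonneg_nonneg) simp_all
  ultimately have "(\<Sum>i<k. c (z i) - \<eta>) \<le> (\<Sum>i<k. c (z' i) + \<eta>)"
    by (simp only: ennreal_le_iff)
  with gap show False by simp
qed

section \<open>Kantorovich potentials\<close>

text \<open>
  Rockafellar's construction. Fix \<open>p \<in> \<Gamma>\<close> and let \<open>\<psi> x\<close> be the infimum of the cost increments
  \<open>c (x\<^sub>i\<^sub>+\<^sub>1, y\<^sub>i) - c (x\<^sub>i, y\<^sub>i)\<close> summed along chains in \<open>\<Gamma>\<close> from \<open>p\<close> to \<open>x\<close>. Closing such a chain into a
  cycle bounds it below by cyclical monotonicity (\<open>lower\<close>); prolonging it by one step gives the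
  inequality \<open>key\<close>, which says that \<open>\<psi> x - c (x, y)\<close> is maximal over \<open>x\<close> when \<open>(x, y) \<in> \<Gamma>\<close>. So that
  maximum defines \<open>\<phi> y\<close>. The potentials are meaningful only on the projections of \<open>\<Gamma>\<close>, and both claims
  speak of no other points.
\<close>

theorem cyclically_monotone_potentials:
  fixes c :: "'a \<times> 'b \<Rightarrow> real"
  assumes cm: "cyclically_monotone c \<Gamma>"
  obtains \<psi> \<phi> where "\<And>x y x' y'. (x, y) \<in> \<Gamma> \<Longrightarrow> (x', y') \<in> \<Gamma> \<Longrightarrow> \<psi> x - \<phi> y' \<le> c (x, y')"
    "\<And>x y. (x, y) \<in> \<Gamma> \<Longrightarrow> \<psi> x - \<phi> y = c (x, y)"
proof (cases "\<Gamma> = {}")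
  case False
  then obtain p where p: "p \<in> \<Gamma>" by blast
  define v where "v z k = (\<Sum>i<k. c (fst (z (Suc i)), snd (z i)) - c (z i))" for z :: "nat \<Rightarrow> 'a \<times> 'b" and k
  \<comment> \<open>Only the first component of the last point of a chain enters its value \<open>v z k\<close>, so the last point
    may be replaced by any other point above \<open>x\<close> (\<open>upd\<close>).\<close>
  define chain where "chain x k z \<longleftrightarrow> 0 < k \<and> z 0 = p \<and> (\<forall>i<k. z i \<in> \<Gamma>) \<and> fst (z k) = x"
    for x k and z :: "nat \<Rightarrow> 'a \<times> 'b"
  define \<psi> where "\<psi> x = Inf {v z k |z k. chain x k z}" for x
  have upd: "v (z(k := (x, y))) k = v z k" if "chain x k z" for x y k z
    using that unfolding v_def chain_def by (intro sum.cong refl) auto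
  have lower: "c (x, y) - c (fst p, y) \<le> v z k" if xy: "(x, y) \<in> \<Gamma>" and ch: "chain x k z" for x y k z
  proof -
    define z' where "z' = z(k := (x, y), Suc k := p)"
    have k: "0 < k" and z: "z 0 = p" "\<And>i. i < k \<Longrightarrow> z i \<in> \<Gamma>" using ch by (auto simp: chain_def)
    have "z' i \<in> \<Gamma>" if "i < Suc k" for i
      using that z(2) xy by (cases "i = k") (simp_all add: z'_def)
    moreover have "z' (Suc k) = z' 0" using k z(1) by (simp add: z'_def)
    ultimately have "(\<Sum>i<Suc k. c (z' i)) \<le> (\<Sum>i<Suc k. c (fst (z' (Suc i)), snd (z' i)))"
      using cm unfolding cyclically_monotone_def by blast
    then have "0 \<le> v z' (Suc k)" by (simp only: v_def sum_subtractf diff_ge_0_iff_ge)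
    also have "v z' (Suc k) = v z' k + (c (fst p, y) - c (x, y))" by (simp add: v_def z'_def)
    also have "v z' k = v (z(k := (x, y))) k"
      unfolding v_def by (intro sum.cong refl) (simp add: z'_def)
    also have "\<dots> = v z k" by (rule upd[OF ch])
    finally show ?thesis by simp
  qed
  have bdd: "bdd_below {v z k |z k. chain x k z}" if "(x, y) \<in> \<Gamma>" for x y
    using lower[OF that] by (intro bdd_belowI[of _ "c (x, y) - c (fst p, y)"]) auto
  have ne: "{v z k |z k. chain x k z} \<noteq> {}" for x
  proof -
    have "chain x 1 (\<lambda>i. if i = 0 then p else (x, undefined))" using p by (simp add: chain_def)
    then show ?thesis by blast
  qed
  have key: "\<psi> x' \<le> \<psi> x + (c (x', y) - c (x, y))" if xy: "(x, y) \<in> \<Gamma>" and x': "(x', y') \<in> \<Gamma>" for x y x' y'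
  proof -
    have "\<psi> x' - (c (x', y) - c (x, y)) \<le> v z k" if ch: "chain x k z" for z k
    proof -
      define z' where "z' = z(k := (x, y), Suc k := (x', y'))"
      have "chain x' (Suc k) z'"
        using ch xy by (auto simp: chain_def z'_def less_Suc_eq)
      then have "\<psi> x' \<le> v z' (Suc k)"
        unfolding \<psi>_def by (intro cInf_lower bdd[OF x']) blast
      also have "v z' (Suc k) = v z' k + (c (x', y) - c (x, y))" by (simp add: v_def z'_def)
      also have "v z' k = v (z(k := (x, y))) k"
        unfolding v_def by (intro sum.cong refl) (simp add: z'_def)
      also have "\<dots> = v z k" by (rule upd[OF ch])
      finally show ?thesis by simp
    qed
    then have "\<psi> x' - (c (x', y) - c (x, y)) \<le> \<psi> x"
      unfolding \<psi>_def[of x] by (intro cInf_greatest ne) blast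
    then show ?thesis by simp
  qed
  define q where "q y = (SOME x. (x, y) \<in> \<Gamma>)" for y
  have q: "(q y, y) \<in> \<Gamma>" if "(x, y) \<in> \<Gamma>" for x y unfolding q_def using that by (rule someI)
  define \<phi> where "\<phi> y = \<psi> (q y) - c (q y, y)" for y
  show thesis
  proof (rule that[of \<psi> \<phi>])
    show "\<psi> x - \<phi> y' \<le> c (x, y')" if "(x, y) \<in> \<Gamma>" "(x', y') \<in> \<Gamma>" for x y x' y'
      using key[OF q[OF that(2)] that(1)] by (simp add: \<phi>_def)
    show "\<psi> x - \<phi> y = c (x, y)" if "(x, y) \<in> \<Gamma>" for x y
      using key[OF q[OF that] that] key[OF that q[OF that]] by (simp add: \<phi>_def)
  qed
qed (rule that, auto)

section \<open>Approximate dual optimizers for the quadratic cost\<close>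

text \<open>
  Adding the square of the norm of \<open>y\<close> turns the supremum into one of affine functions of \<open>y\<close>, which is a
  finite convex function on a Euclidean space and therefore continuous.
\<close>

lemma continuous_on_sup_conjugate:
  fixes g :: "'a::euclidean_space \<Rightarrow> real"
  assumes g: "\<And>x. g x \<le> n"
  shows "continuous_on UNIV (\<lambda>y. SUP x. g x - (norm (x - y))\<^sup>2)"
proof -
  define h where "h x y = g x - (norm (x - y))\<^sup>2 + (norm y)\<^sup>2" for x y
  have h: "h x y = (g x - (norm x)\<^sup>2) + 2 * (x \<bullet> y)" for x y
    by (simp add: h_def power2_norm_eq_inner inner_diff_left inner_diff_right inner_commute)
  have bdd0: "bdd_above (range (\<lambda>x. g x - (norm (x - y))\<^sup>2))" for y
  proof (intro bdd_aboveI[of _ n], elim rangeE)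
    fix r x assume "r = g x - (norm (x - y))\<^sup>2"
    then show "r \<le> n" using g[of x] zero_le_power2[of "norm (x - y)"] by linarith
  qed
  have bdd: "bdd_above (range (\<lambda>x. h x y))" for y
  proof (intro bdd_aboveI[of _ "n + (norm y)\<^sup>2"], elim rangeE)
    fix r x assume "r = h x y"
    then show "r \<le> n + (norm y)\<^sup>2" using g[of x] zero_le_power2[of "norm (x - y)"] unfolding h_def by linarith
  qed
  have eq: "(SUP x. g x - (norm (x - y))\<^sup>2) = (SUP x. h x y) - (norm y)\<^sup>2" for y
  proof (rule antisym)
    show "(SUP x. g x - (norm (x - y))\<^sup>2) \<le> (SUP x. h x y) - (norm y)\<^sup>2"
    proof (rule cSUP_least)
      fix x show "g x - (norm (x - y))\<^sup>2 \<le> (SUP x. h x y) - (norm y)\<^sup>2"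
        using cSUP_upper[OF UNIV_I bdd, of x y] by (simp add: h_def)
    qed simp
    have "(SUP x. h x y) \<le> (SUP x. g x - (norm (x - y))\<^sup>2) + (norm y)\<^sup>2"
    proof (rule cSUP_least)
      fix x show "h x y \<le> (SUP x. g x - (norm (x - y))\<^sup>2) + (norm y)\<^sup>2"
        using cSUP_upper[OF UNIV_I bdd0, of x y] by (simp add: h_def)
    qed simp
    then show "(SUP x. h x y) - (norm y)\<^sup>2 \<le> (SUP x. g x - (norm (x - y))\<^sup>2)" by simp
  qed
  have "convex_on UNIV (\<lambda>y. SUP x. h x y)"
  proof (rule convex_onI)
    fix t :: real and y y' :: 'a
    assume t: "0 < t" "t < 1"
    show "(SUP x. h x ((1 - t) *\<^sub>R y + t *\<^sub>R y')) \<le> (1 - t) * (SUP x. h x y) + t * (SUP x. h x y')"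
    proof (rule cSUP_least)
      fix x
      have "h x ((1 - t) *\<^sub>R y + t *\<^sub>R y') = (1 - t) * h x y + t * h x y'"
        unfolding h by (simp add: inner_add_right algebra_simps)
      also have "\<dots> \<le> (1 - t) * (SUP x. h x y) + t * (SUP x. h x y')"
        using t cSUP_upper[OF UNIV_I bdd, of x] by (intro add_mono mult_left_mono) simp_all
      finally show "h x ((1 - t) *\<^sub>R y + t *\<^sub>R y') \<le> \<dots>" .
    qed simp
  qed simp
  then have "continuous_on UNIV (\<lambda>y. SUP x. h x y)"
    by (intro convex_on_continuous) simp_all
  then show ?thesis unfolding eq by (intro continuous_intros)
qed

lemma c_transform_le:
  assumes "\<And>y. l \<le> \<phi> y"
  shows "c_transform \<phi> x \<le> (norm (x - y))\<^sup>2 + \<phi> y"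
  unfolding c_transform_def
proof (rule cINF_lower[OF _ UNIV_I], intro bdd_belowI[of _ l], elim rangeE)
  fix r z assume "r = (norm (x - z))\<^sup>2 + \<phi> z"
  then show "l \<le> r" using assms[of z] zero_le_power2[of "norm (x - z)"] by linarith
qed

lemma c_transform_ge:
  assumes "\<And>y. v \<le> (norm (x - y))\<^sup>2 + \<phi> y"
  shows "v \<le> c_transform \<phi> x"
  unfolding c_transform_def using assms by (intro cINF_greatest) simp_all

lemma c_transform_bcontfun:
  fixes \<phi> :: "'a::euclidean_space \<Rightarrow> real"
  assumes "\<phi> \<in> bcontfun"
  shows "c_transform \<phi> \<in> bcontfun"
proof -
  obtain n where n: "\<And>y. \<bar>\<phi> y\<bar> \<le> n"
    using assms by (auto simp: bcontfun_def bounded_iff)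
  have n': "- n \<le> \<phi> y" "\<phi> y \<le> n" for y using n[of y] by linarith+
  have "c_transform \<phi> x = - (SUP y. - \<phi> y - (norm (y - x))\<^sup>2)" for x
    unfolding c_transform_def Inf_real_def by (simp add: image_comp norm_minus_commute algebra_simps)
  moreover have "continuous_on UNIV (\<lambda>x. SUP y. - \<phi> y - (norm (y - x))\<^sup>2)"
    by (rule continuous_on_sup_conjugate[of _ n]) (use n' in \<open>simp add: minus_le_iff\<close>)
  ultimately have "continuous_on UNIV (c_transform \<phi>)"
    by (simp add: continuous_on_minus)
  moreover have "\<bar>c_transform \<phi> x\<bar> \<le> n" for x
  proof -
    have "- n \<le> c_transform \<phi> x"
    proof (rule c_transform_ge)
      fix y show "- n \<le> (norm (x - y))\<^sup>2 + \<phi> y" using n'(1)[of y] zero_le_power2[of "norm (x - y)"] by linarith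
    qed
    moreover have "c_transform \<phi> x \<le> n"
      using c_transform_le[of "- n" \<phi> x x] n' by (simp add: order.trans)
    ultimately show ?thesis by simp
  qed
  ultimately show ?thesis by (auto simp: bcontfun_def bounded_iff)
qed

lemma integrable_bcontfun:
  fixes f :: "'a::topological_space \<Rightarrow> real"
  assumes "f \<in> bcontfun" "finite_measure M" "sets M = sets borel"
  shows "integrable M f"
proof -
  interpret finite_measure M by fact
  obtain n where n: "\<And>x. norm (f x) \<le> n" using assms(1) by (auto simp: bcontfun_def bounded_iff)
  have "f \<in> borel_measurable borel"
    using assms(1) by (intro borel_measurable_continuous_onI) (simp add: bcontfun_def)
  then have "f \<in> borel_measurable M" by (simp add: measurable_cong_sets[OF assms(3) refl])
  then show ?thesis using n by (intro integrable_const_bound[of _ n]) simp_all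
qed

definition clamp_at :: "nat \<Rightarrow> real \<Rightarrow> real" where
  "clamp_at n t = max (- real n) (min (real n) t)"

lemma clamp_at_bounds: "- real n \<le> clamp_at n t" "clamp_at n t \<le> real n"
  by (auto simp: clamp_at_def)

lemma clamp_at_diff_le: "s - t \<le> d \<Longrightarrow> 0 \<le> d \<Longrightarrow> clamp_at n s - clamp_at n t \<le> d"
  by (auto simp: clamp_at_def max_def min_def)

lemma clamp_at_mono: "s \<le> t \<Longrightarrow> clamp_at n s \<le> clamp_at n t"
  by (auto simp: clamp_at_def max_def min_def)

lemma clamp_at_eventually: "eventually (\<lambda>n. clamp_at n t = t) sequentially"
  using eventually_ge_at_top[of "nat \<lceil>\<bar>t\<bar>\<rceil>"]
proof eventually_elim
  case (elim n)
  then have "\<bar>t\<bar> \<le> real n" by linarith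
  then show ?case by (auto simp: clamp_at_def)
qed

text \<open>
  The potentials of \<open>\<Gamma>\<close> may be unbounded and discontinuous. Clamping both of them to \<open>[-n, n]\<close> preserves
  \<open>\<psi> x - \<phi> y \<le> |x - y|\<^sup>2\<close> because the cost is nonnegative. Extending the clamped \<open>\<psi>\<close> by its least value
  \<open>- n\<close> and taking its conjugate yields \<open>\<Phi> n\<close>, bounded and continuous, which improves on the clamped pair
  on \<open>\<Gamma>\<close>. There the dual integrand \<open>G n\<close> lies between \<open>0\<close> and the cost and is eventually equal to the
  cost, so dominated convergence with respect to \<open>\<pi>\<close> gives the limit. Dominating by the cost avoids any
  integrability question for the potentials themselves.
\<close>

theorem cyclically_monotone_dual_approximation:
  fixes \<mu> \<nu> :: "'a::euclidean_space measure"
  assumes \<mu>: "prob_space \<mu>" "sets \<mu> = sets borel" and \<nu>: "prob_space \<nu>" "sets \<nu> = sets borel"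
    and \<pi>: "\<pi> \<in> couplings \<mu> \<nu>"
    and int: "integrable \<pi> (\<lambda>(x, y). (norm (x - y))\<^sup>2)"
    and \<Gamma>: "AE z in \<pi>. z \<in> \<Gamma>" "cyclically_monotone (\<lambda>(x, y). (norm (x - y))\<^sup>2) \<Gamma>"
  obtains \<Phi> :: "nat \<Rightarrow> 'a \<Rightarrow> real" where "\<And>n. \<Phi> n \<in> bcontfun"
    "(\<lambda>n. (\<integral>x. c_transform (\<Phi> n) x \<partial>\<mu>) - (\<integral>y. \<Phi> n y \<partial>\<nu>)) \<longlonglongrightarrow> (\<integral>(x, y). (norm (x - y))\<^sup>2 \<partial>\<pi>)"
proof -
  interpret \<mu>: prob_space \<mu> by fact
  interpret \<nu>: prob_space \<nu> by fact
  interpret \<pi>: prob_space \<pi> by (rule couplings_prob_space[OF \<pi> \<mu>(1)])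
  obtain \<psi> \<phi> where pot0: "\<And>x y x' y'. (x, y) \<in> \<Gamma> \<Longrightarrow> (x', y') \<in> \<Gamma> \<Longrightarrow> \<psi> x - \<phi> y' \<le> (case (x, y') of (x, y) \<Rightarrow> (norm (x - y))\<^sup>2)"
    "\<And>x y. (x, y) \<in> \<Gamma> \<Longrightarrow> \<psi> x - \<phi> y = (case (x, y) of (x, y) \<Rightarrow> (norm (x - y))\<^sup>2)"
    by (rule cyclically_monotone_potentials[OF \<Gamma>(2)]) (rule that)
  then have pot: "\<And>x y x' y'. (x, y) \<in> \<Gamma> \<Longrightarrow> (x', y') \<in> \<Gamma> \<Longrightarrow> \<psi> x - \<phi> y' \<le> (norm (x - y'))\<^sup>2"
    "\<And>x y. (x, y) \<in> \<Gamma> \<Longrightarrow> \<psi> x - \<phi> y = (norm (x - y))\<^sup>2" by simp_all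
  define \<Psi> where "\<Psi> n x = (if x \<in> fst ` \<Gamma> then clamp_at n (\<psi> x) else - real n)" for n x
  have \<Psi>: "- real n \<le> \<Psi> n x" "\<Psi> n x \<le> real n" for n x
    using clamp_at_bounds[of n "\<psi> x"] by (simp_all add: \<Psi>_def)
  define \<Phi> where "\<Phi> n y = (SUP x. \<Psi> n x - (norm (x - y))\<^sup>2)" for n y
  have bdd: "bdd_above (range (\<lambda>x. \<Psi> n x - (norm (x - y))\<^sup>2))" for n y
  proof (intro bdd_aboveI[of _ "real n"], elim rangeE)
    fix r x assume "r = \<Psi> n x - (norm (x - y))\<^sup>2"
    then show "r \<le> real n" using \<Psi>(2)[of n x] zero_le_power2[of "norm (x - y)"] by linarith
  qed
  have \<Phi>_ge: "\<Psi> n x - (norm (x - y))\<^sup>2 \<le> \<Phi> n y" for n x y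
    unfolding \<Phi>_def by (rule cSUP_upper[OF UNIV_I bdd])
  have \<Phi>_le: "\<Phi> n y \<le> v" if "\<And>x. \<Psi> n x - (norm (x - y))\<^sup>2 \<le> v" for n y v
    unfolding \<Phi>_def using that by (intro cSUP_least) simp_all
  have \<Phi>_bounds: "- real n \<le> \<Phi> n y" "\<Phi> n y \<le> real n" for n y
  proof -
    show "- real n \<le> \<Phi> n y" using \<Phi>_ge[of n y y] \<Psi>(1)[of n y] by simp
    show "\<Phi> n y \<le> real n"
    proof (rule \<Phi>_le)
      fix x show "\<Psi> n x - (norm (x - y))\<^sup>2 \<le> real n"
        using \<Psi>(2)[of n x] zero_le_power2[of "norm (x - y)"] by linarith
    qed
  qed
  have bc: "\<Phi> n \<in> bcontfun" for n
  proof -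
    have "continuous_on UNIV (\<Phi> n)"
      unfolding \<Phi>_def by (rule continuous_on_sup_conjugate) (rule \<Psi>(2))
    moreover have "norm (\<Phi> n y) \<le> real n" for y using \<Phi>_bounds[of n y] by (simp add: abs_le_iff)
    ultimately show ?thesis by (auto simp: bcontfun_def bounded_iff)
  qed
  define G where "G n z = c_transform (\<Phi> n) (fst z) - \<Phi> n (snd z)" for n and z :: "'a \<times> 'a"
  have G_le: "G n (x, y) \<le> (norm (x - y))\<^sup>2" for n x y
    using c_transform_le[of "- real n" "\<Phi> n" x y] \<Phi>_bounds(1) by (simp add: G_def)
  have G_ge: "clamp_at n (\<psi> x) - clamp_at n (\<phi> y) \<le> G n (x, y)" if xy: "(x, y) \<in> \<Gamma>" for n x y
  proof -
    have "\<Psi> n x = clamp_at n (\<psi> x)" using xy by (auto simp: \<Psi>_def image_iff)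
    moreover have "\<Psi> n x \<le> c_transform (\<Phi> n) x"
    proof (rule c_transform_ge)
      fix y show "\<Psi> n x \<le> (norm (x - y))\<^sup>2 + \<Phi> n y" using \<Phi>_ge[of n x y] by simp
    qed
    moreover have "\<Phi> n y \<le> clamp_at n (\<phi> y)"
    proof (rule \<Phi>_le)
      fix x'
      show "\<Psi> n x' - (norm (x' - y))\<^sup>2 \<le> clamp_at n (\<phi> y)"
      proof (cases "x' \<in> fst ` \<Gamma>")
        case True
        then obtain y' where "(x', y') \<in> \<Gamma>" by auto
        from clamp_at_diff_le[OF pot(1)[OF this xy], of n] True show ?thesis by (simp add: \<Psi>_def)
      next
        case False
        then have "\<Psi> n x' = - real n" by (simp add: \<Psi>_def)
        then show ?thesis
          using clamp_at_bounds(1)[of n "\<phi> y"] zero_le_power2[of "norm (x' - y)"] by linarith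
      qed
    qed
    ultimately show ?thesis by (simp add: G_def)
  qed
  have G_lim: "(\<lambda>n. G n (x, y)) \<longlonglongrightarrow> (norm (x - y))\<^sup>2" if xy: "(x, y) \<in> \<Gamma>" for x y
  proof (rule tendsto_eventually)
    show "eventually (\<lambda>n. G n (x, y) = (norm (x - y))\<^sup>2) sequentially"
      using clamp_at_eventually[of "\<psi> x"] clamp_at_eventually[of "\<phi> y"]
    proof eventually_elim
      case (elim n)
      then show ?case using G_ge[OF xy, of n] G_le[of n x y] pot(2)[OF xy] by simp
    qed
  qed
  have G_nonneg: "0 \<le> G n (x, y)" if xy: "(x, y) \<in> \<Gamma>" for n x y
  proof -
    have "\<phi> y \<le> \<psi> x" using pot(2)[OF xy] zero_le_power2[of "norm (x - y)"] by linarith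
    from clamp_at_mono[OF this, of n] show ?thesis using G_ge[OF xy, of n] by linarith
  qed
  have cont: "continuous_on UNIV f" if "f \<in> bcontfun" for f :: "'a \<Rightarrow> real"
    using that by (simp add: bcontfun_def)
  have m1: "c_transform (\<Phi> n) \<in> borel_measurable borel" "\<Phi> n \<in> borel_measurable borel" for n
    by (intro borel_measurable_continuous_onI cont bc c_transform_bcontfun)+
  have ctm: "(\<lambda>z. c_transform (\<Phi> n) (fst z)) \<in> borel_measurable \<pi>"
    and pm: "(\<lambda>z. \<Phi> n (snd z)) \<in> borel_measurable \<pi>" for n
    by (rule measurable_compose[OF couplings_measurable_fst[OF \<pi>] m1(1)],
        rule measurable_compose[OF couplings_measurable_snd[OF \<pi>] m1(2)])
  have split: "(\<integral>z. G n z \<partial>\<pi>) = (\<integral>x. c_transform (\<Phi> n) x \<partial>\<mu>) - (\<integral>y. \<Phi> n y \<partial>\<nu>)" for n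
  proof -
    have i1: "integrable \<pi> (\<lambda>z. c_transform (\<Phi> n) (fst z))"
      using integrable_bcontfun[OF c_transform_bcontfun[OF bc] \<mu>.finite_measure_axioms \<mu>(2), of n]
        integrable_distr_eq[OF couplings_measurable_fst[OF \<pi>] m1(1)] couplings_fst[OF \<pi>] by simp
    have i2: "integrable \<pi> (\<lambda>z. \<Phi> n (snd z))"
      using integrable_bcontfun[OF bc \<nu>.finite_measure_axioms \<nu>(2), of n]
        integrable_distr_eq[OF couplings_measurable_snd[OF \<pi>] m1(2)] couplings_snd[OF \<pi>] by simp
    have "(\<integral>z. G n z \<partial>\<pi>) = (\<integral>z. c_transform (\<Phi> n) (fst z) \<partial>\<pi>) - (\<integral>z. \<Phi> n (snd z) \<partial>\<pi>)"
      unfolding G_def by (rule Bochner_Integration.integral_diff[OF i1 i2])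
    then show ?thesis
      using integral_distr[OF couplings_measurable_fst[OF \<pi>] m1(1)]
        integral_distr[OF couplings_measurable_snd[OF \<pi>] m1(2)] couplings_fst[OF \<pi>] couplings_snd[OF \<pi>] by simp
  qed
  have "(\<lambda>n. \<integral>z. G n z \<partial>\<pi>) \<longlonglongrightarrow> (\<integral>(x, y). (norm (x - y))\<^sup>2 \<partial>\<pi>)"
  proof (rule integral_dominated_convergence[OF _ _ int])
    show "(\<lambda>(x, y). (norm (x - y))\<^sup>2) \<in> borel_measurable \<pi>" using int by (rule borel_measurable_integrable)
    show "G n \<in> borel_measurable \<pi>" for n
      unfolding G_def using ctm pm by (rule borel_measurable_diff)
    show "AE z in \<pi>. (\<lambda>n. G n z) \<longlonglongrightarrow> (case z of (x, y) \<Rightarrow> (norm (x - y))\<^sup>2)"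
      using \<Gamma>(1) by eventually_elim (auto intro: G_lim)
    show "AE z in \<pi>. norm (G n z) \<le> (case z of (x, y) \<Rightarrow> (norm (x - y))\<^sup>2)" for n
      using \<Gamma>(1) by eventually_elim (auto simp: G_nonneg G_le)
  qed
  then show thesis using that[of \<Phi>, OF bc] unfolding split by simp
qed

section \<open>The dual value bounds the action from below\<close>

lemma norm_set_integral_square_le:
  fixes f :: "real \<Rightarrow> 'a::euclidean_space"
  assumes "set_integrable lborel {0..1} f"
  shows "ennreal ((norm (LINT s:{0..1}|lborel. f s))\<^sup>2) \<le> (\<integral>\<^sup>+ s\<in>{0..1}. ennreal ((norm (f s))\<^sup>2) \<partial>lborel)"
proof -
  let ?g = "\<lambda>s. indicator {0..1::real} s *\<^sub>R f s"
  have int: "integrable lborel ?g" using assms unfolding set_integrable_def .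
  have m: "(\<lambda>s. ennreal (norm (?g s))) \<in> borel_measurable lborel"
    by (rule measurable_compose[OF measurable_compose[OF borel_measurable_integrable[OF int] borel_measurable_norm] measurable_ennreal])
  have m1: "(indicator {0..1::real} :: real \<Rightarrow> ennreal) \<in> borel_measurable lborel"
    by (rule borel_measurable_indicator) simp
  have "ennreal (norm (LINT s:{0..1}|lborel. f s)) \<le> (\<integral>\<^sup>+s. norm (?g s) \<partial>lborel)"
    unfolding set_lebesgue_integral_def by (rule integral_norm_bound_ennreal[OF int])
  also have "\<dots> = (\<integral>\<^sup>+s. ennreal (norm (?g s)) * indicator {0..1} s \<partial>lborel)"
    by (intro nn_integral_cong) (simp split: split_indicator)
  finally have "(ennreal (norm (LINT s:{0..1}|lborel. f s)))\<^sup>2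
      \<le> (\<integral>\<^sup>+s. ennreal (norm (?g s)) * indicator {0..1} s \<partial>lborel)\<^sup>2"
    by (rule power_mono) simp
  also have "\<dots> \<le> (\<integral>\<^sup>+s. (ennreal (norm (?g s)))\<^sup>2 \<partial>lborel) * (\<integral>\<^sup>+s. (indicator {0..1} s)\<^sup>2 \<partial>(lborel :: real measure))"
    by (rule Cauchy_Schwarz_nn_integral[OF m m1])
  also have "(\<integral>\<^sup>+s. (indicator {0..1} s)\<^sup>2 \<partial>(lborel :: real measure)) = (\<integral>\<^sup>+s. indicator {0..1} s \<partial>(lborel :: real measure))"
    by (intro nn_integral_cong) (simp split: split_indicator)
  also have "\<dots> = 1" by simp
  also have "(\<integral>\<^sup>+s. (ennreal (norm (?g s)))\<^sup>2 \<partial>lborel) = (\<integral>\<^sup>+ s\<in>{0..1}. ennreal ((norm (f s))\<^sup>2) \<partial>lborel)"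
    by (intro nn_integral_cong) (simp add: ennreal_power split: split_indicator)
  finally show ?thesis by (simp add: ennreal_power)
qed

text \<open>
  Almost surely \<open>c_transform \<phi> (X\<^sub>0) - \<phi> (X\<^sub>1) \<le> |X\<^sub>0 - X\<^sub>1|\<^sup>2\<close>, and the displacement is the time integral of
  the drift, so its square is at most the time integral of the squared drift. Take expectations.
\<close>

theorem dual_le_action:
  fixes \<mu>0 \<mu>1 :: "'a::euclidean_space measure"
  assumes adm: "(P, b) \<in> BB_admissible \<mu>0 \<mu>1" and \<phi>: "\<phi> \<in> bcontfun"
  shows "ereal ((\<integral>x. c_transform \<phi> x \<partial>\<mu>0) - (\<integral>y. \<phi> y \<partial>\<mu>1)) \<le> enn2ereal (action P b)"
proof -
  have P: "prob_space P" and dp: "drift_process P coordinate_process b"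
    and d0: "distr P borel (\<lambda>w. w 0) = \<mu>0" and d1: "distr P borel (\<lambda>w. w 1) = \<mu>1"
    using adm by (auto simp: BB_admissible_def)
  interpret prob_space P by fact
  have X: "(\<lambda>w. w t) \<in> borel_measurable P" if "t \<in> {0..1}" for t
    using dp that unfolding drift_process_def by blast
  have X0: "(\<lambda>w. w 0) \<in> borel_measurable P" and X1: "(\<lambda>w. w 1) \<in> borel_measurable P"
    using X[of 0] X[of 1] by simp_all
  have cont: "continuous_on UNIV f" if "f \<in> bcontfun" for f :: "'a \<Rightarrow> real"
    using that by (simp add: bcontfun_def)
  note c\<phi> = c_transform_bcontfun[OF \<phi>]
  have m0: "c_transform \<phi> \<in> borel_measurable borel" and m1: "\<phi> \<in> borel_measurable borel"
    by (intro borel_measurable_continuous_onI cont \<phi> c\<phi>)+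
  have fin: "finite_measure (distr P borel (\<lambda>w. w 0))" "finite_measure (distr P borel (\<lambda>w. w 1))"
    using finite_measure_distr[OF X0] finite_measure_distr[OF X1] by simp_all
  have i0: "integrable P (\<lambda>w. c_transform \<phi> (w 0))"
    using integrable_bcontfun[OF c\<phi> fin(1) sets_distr] unfolding integrable_distr_eq[OF X0 m0] .
  have i1: "integrable P (\<lambda>w. \<phi> (w 1))"
    using integrable_bcontfun[OF \<phi> fin(2) sets_distr] unfolding integrable_distr_eq[OF X1 m1] .
  obtain n where n: "\<And>y. \<bar>\<phi> y\<bar> \<le> n"
    using \<phi> by (auto simp: bcontfun_def bounded_iff)
  have lower: "- n \<le> \<phi> y" for y using n[of y] by linarith
  define g where "g w = c_transform \<phi> (w 0) - \<phi> (w 1)" for w :: "real \<Rightarrow> 'a"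
  have g: "integrable P g" unfolding g_def using i0 i1 by (rule Bochner_Integration.integrable_diff)
  define D where "D = (\<integral>x. c_transform \<phi> x \<partial>\<mu>0) - (\<integral>y. \<phi> y \<partial>\<mu>1)"
  have "D = (\<integral>w. c_transform \<phi> (w 0) \<partial>P) - (\<integral>w. \<phi> (w 1) \<partial>P)"
    unfolding D_def d0[symmetric] d1[symmetric] integral_distr[OF X0 m0] integral_distr[OF X1 m1] ..
  also have "\<dots> = (\<integral>w. g w \<partial>P)"
    unfolding g_def by (rule Bochner_Integration.integral_diff[OF i0 i1, symmetric])
  also have "\<dots> \<le> (\<integral>w. max 0 (g w) \<partial>P)"
    using g by (intro integral_mono Bochner_Integration.integrable_max) simp_all
  finally have "ennreal D \<le> ennreal (\<integral>w. max 0 (g w) \<partial>P)" by (rule ennreal_leI)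
  also have "\<dots> = (\<integral>\<^sup>+w. ennreal (max 0 (g w)) \<partial>P)"
    using g by (intro nn_integral_eq_integral[symmetric] Bochner_Integration.integrable_max) simp_all
  also have "\<dots> = (\<integral>\<^sup>+w. ennreal (g w) \<partial>P)"
    by (intro nn_integral_cong) (simp add: max_def ennreal_neg)
  also have "\<dots> \<le> action P b"
    unfolding action_def
  proof (rule nn_integral_mono_AE)
    have "AE w in P. set_integrable lborel {0..1} (\<lambda>s. b s w) \<and>
        (\<forall>t\<in>{0..1}. w t = w 0 + (LINT s:{0..t}|lborel. b s w))"
      using dp unfolding drift_process_def by blast
    then show "AE w in P. ennreal (g w) \<le> (\<integral>\<^sup>+ t\<in>{0..1}. ennreal ((norm (b t w))\<^sup>2) \<partial>lborel)"
    proof eventually_elim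
      case (elim w)
      have "w 1 = w 0 + (LINT s:{0..1}|lborel. b s w)"
        by (rule bspec[OF conjunct2[OF elim]]) simp
      then have "norm (w 0 - w 1) = norm (LINT s:{0..1}|lborel. b s w)" by simp
      then have "g w \<le> (norm (LINT s:{0..1}|lborel. b s w))\<^sup>2"
        using c_transform_le[where \<phi> = \<phi>, OF lower, of "w 0" "w 1"] by (simp add: g_def)
      then have "ennreal (g w) \<le> ennreal ((norm (LINT s:{0..1}|lborel. b s w))\<^sup>2)" by (rule ennreal_leI)
      also have "\<dots> \<le> (\<integral>\<^sup>+ t\<in>{0..1}. ennreal ((norm (b t w))\<^sup>2) \<partial>lborel)"
        by (rule norm_set_integral_square_le[OF conjunct1[OF elim]])
      finally show ?case .
    qed
  qed
  finally have "ennreal (max 0 D) \<le> action P b" by (simp add: max_def ennreal_neg split: if_splits)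
  then have "enn2ereal (ennreal (max 0 D)) \<le> enn2ereal (action P b)" by (simp only: less_eq_ennreal.rep_eq)
  moreover have "enn2ereal (ennreal (max 0 D)) = ereal (max 0 D)" by (rule enn2ereal_ennreal) simp
  then have "ereal D \<le> enn2ereal (ennreal (max 0 D))" by simp
  ultimately show ?thesis unfolding D_def by (rule order.trans[rotated])
qed

section \<open>Lifting a coupling to straight paths\<close>

lemma measurable_path_eval:
  assumes "t \<in> {0..1}"
  shows "(\<lambda>w. w t) \<in> borel_measurable (path_space :: (real \<Rightarrow> 'a::topological_space) measure)"
  unfolding path_space_def using assms
  by (intro measurable_restrict_space1 measurable_component_singleton)

lemma path_space_continuous:
  "w \<in> space path_space \<Longrightarrow> continuous_on {0..1} w"
  by (simp add: path_space_def space_restrict_space)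

text \<open>
  Largest multiple of \<open>1 / (n + 1)\<close> not exceeding \<open>t\<close>. The minimum with \<open>1\<close> keeps every value of the countable
  grid, not only those reached from \<open>t \<in> {0..1}\<close>, inside the time interval on which paths are defined.
\<close>

definition grid_floor :: "nat \<Rightarrow> real \<Rightarrow> real" where
  "grid_floor n t = min 1 (real (nat \<lfloor>real (Suc n) * t\<rfloor>) / real (Suc n))"

lemma grid_floor_in: "grid_floor n t \<in> {0..1}"
  by (simp add: grid_floor_def)

lemma grid_floor_tendsto:
  assumes "t \<in> {0..1}"
  shows "(\<lambda>n. grid_floor n t) \<longlonglongrightarrow> t"
proof (rule tendsto_sandwich)
  have "(\<lambda>n. t - 1 / real (Suc n)) \<longlonglongrightarrow> t - 0"
    by (intro tendsto_diff tendsto_const LIMSEQ_Suc[OF lim_1_over_n])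
  then show "(\<lambda>n. t - 1 / real (Suc n)) \<longlonglongrightarrow> t" by simp
  have f: "real (Suc n) * t - 1 \<le> real (nat \<lfloor>real (Suc n) * t\<rfloor>)"
    "real (nat \<lfloor>real (Suc n) * t\<rfloor>) \<le> real (Suc n) * t" for n
    using assms by linarith (simp add: assms[simplified])
  have "t - 1 / real (Suc n) \<le> grid_floor n t" for n
  proof -
    have "t - 1 / real (Suc n) = (real (Suc n) * t - 1) / real (Suc n)" by (simp add: field_simps del: of_nat_Suc)
    also have "\<dots> \<le> real (nat \<lfloor>real (Suc n) * t\<rfloor>) / real (Suc n)" by (intro divide_right_mono f) simp
    finally have "t - 1 / real (Suc n) \<le> real (nat \<lfloor>real (Suc n) * t\<rfloor>) / real (Suc n)" .
    moreover have "t - 1 / real (Suc n) \<le> 1"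
      using assms by (simp add: algebra_simps add_increasing2 del: of_nat_Suc)
    ultimately show ?thesis by (simp add: grid_floor_def)
  qed
  then show "eventually (\<lambda>n. t - 1 / real (Suc n) \<le> grid_floor n t) sequentially" by simp
  have "grid_floor n t \<le> t" for n
  proof -
    have "real (nat \<lfloor>real (Suc n) * t\<rfloor>) / real (Suc n) \<le> (real (Suc n) * t) / real (Suc n)"
      by (intro divide_right_mono f) simp
    also have "\<dots> = t" by simp
    finally show ?thesis unfolding grid_floor_def by (rule min.coboundedI2)
  qed
  then show "eventually (\<lambda>n. grid_floor n t \<le> t) sequentially" by simp
qed simp

lemma path_grid_tendsto:
  assumes "continuous_on {0..1} w" "t \<in> {0..1}"
  shows "(\<lambda>n. w (grid_floor n t)) \<longlonglongrightarrow> w t"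
  using assms grid_floor_tendsto[OF assms(2)] grid_floor_in
  by (intro continuous_on_tendsto_compose[OF assms(1)] always_eventually allI)

lemma path_eval_jointly_measurable:
  "(\<lambda>(t, w). w t) \<in> borel_measurable
     (restrict_space borel {0..1} \<Otimes>\<^sub>M (path_space :: (real \<Rightarrow> 'a::metric_space) measure))"
  (is "_ \<in> borel_measurable ?M")
proof (rule borel_measurable_LIMSEQ_metric)
  fix n
  have e: "(\<lambda>z. snd z (min 1 (real i / real (Suc n)))) \<in> borel_measurable ?M" for i
    by (rule measurable_compose[OF measurable_snd measurable_path_eval]) simp
  have "(\<lambda>z. fst z) \<in> borel_measurable ?M"
    by (rule measurable_compose[OF measurable_fst]) (rule measurable_restrict_space1, simp)
  then have "(\<lambda>z. nat \<lfloor>real (Suc n) * fst z\<rfloor>) \<in> measurable ?M (count_space UNIV)" by measurable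
  from measurable_compose_countable[OF e this]
  show "(\<lambda>z. case z of (t, w) \<Rightarrow> w (grid_floor n t)) \<in> borel_measurable ?M"
    by (simp add: grid_floor_def case_prod_beta)
next
  fix z assume "z \<in> space ?M"
  then have "fst z \<in> {0..1}" "snd z \<in> space path_space"
    by (auto simp: space_pair_measure space_restrict_space)
  then show "(\<lambda>n. case z of (t, w) \<Rightarrow> w (grid_floor n t)) \<longlonglongrightarrow> (case z of (t, w) \<Rightarrow> w t)"
    unfolding case_prod_beta by (intro path_grid_tendsto path_space_continuous)
qed

definition segment_path :: "'a::real_vector \<times> 'a \<Rightarrow> real \<Rightarrow> 'a" where
  "segment_path z = (\<lambda>t\<in>{0..1}. fst z + t *\<^sub>R (snd z - fst z))"

lemma segment_path_ends: "segment_path z 0 = fst z" "segment_path z 1 = snd z"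
  by (simp_all add: segment_path_def)

lemma measurable_segment_path:
  "segment_path \<in> measurable borel (path_space :: (real \<Rightarrow> 'a::euclidean_space) measure)"
  unfolding path_space_def
proof (rule measurable_restrict_space2)
  have "continuous_on {0..1} (segment_path z)" for z :: "'a \<times> 'a"
  proof (rule continuous_on_eq)
    show "continuous_on {0..1} (\<lambda>t. fst z + t *\<^sub>R (snd z - fst z))" by (intro continuous_intros)
  qed (simp add: segment_path_def)
  then show "segment_path \<in> space (borel :: ('a \<times> 'a) measure) \<rightarrow> {w. continuous_on {0..1} w}" by simp
  have "(\<lambda>z :: 'a \<times> 'a. fst z + t *\<^sub>R (snd z - fst z)) \<in> borel_measurable borel" for t
    by (intro borel_measurable_continuous_onI continuous_intros)
  then show "segment_path \<in> measurable (borel :: ('a \<times> 'a) measure) (Pi\<^sub>M {0..1} (\<lambda>_. borel))"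
    unfolding segment_path_def by (intro measurable_restrict)
qed

text \<open>
  The velocity of a straight path as a functional of its past, as adaptedness demands. At time \<open>0\<close> the
  past determines no velocity; a single time is a null set, so any
  constant may serve as the value there.
\<close>

definition secant_drift :: "real \<Rightarrow> (real \<Rightarrow> 'a::real_vector) \<Rightarrow> 'a" where
  "secant_drift t w = (if t = 0 then 0 else (w t - w 0) /\<^sub>R t)"

lemma natural_filtration_eval:
  assumes "s \<in> {0..t}"
  shows "X s \<in> borel_measurable (natural_filtration M X t)"
proof (rule measurableI)
  let ?G = "{X s -` A \<inter> space M | s A. s \<in> {0..t} \<and> A \<in> sets borel}"
  have sub: "?G \<subseteq> Pow (space M)" by auto
  have sp: "space (natural_filtration M X t) = space M"
    unfolding natural_filtration_def by (rule space_measure_of[OF sub])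
  fix A :: "'b set" assume A: "A \<in> sets borel"
  have "X s -` A \<inter> space M \<in> ?G" using assms A by blast
  then show "X s -` A \<inter> space (natural_filtration M X t) \<in> sets (natural_filtration M X t)"
    unfolding sp unfolding natural_filtration_def sets_measure_of[OF sub] by (rule sigma_sets.Basic)
qed simp

lemma secant_drift_adapted:
  fixes P :: "(real \<Rightarrow> 'a::euclidean_space) measure"
  assumes "t \<in> {0..1}"
  shows "secant_drift t \<in> borel_measurable (natural_filtration P coordinate_process t)"
proof -
  have t: "(\<lambda>w. w t) \<in> borel_measurable (natural_filtration P coordinate_process t)"
    and z: "(\<lambda>w. w 0) \<in> borel_measurable (natural_filtration P coordinate_process t)"
    using natural_filtration_eval[of t t coordinate_process P] natural_filtration_eval[of 0 t coordinate_process P] assms by simp_all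
  show ?thesis
    unfolding secant_drift_def
    by (cases "t = 0") (simp_all add: borel_measurable_scaleR borel_measurable_diff t z)
qed

lemma secant_drift_jointly_measurable:
  "(\<lambda>(t, w). secant_drift t w) \<in> borel_measurable
     (restrict_space borel {0..1} \<Otimes>\<^sub>M (path_space :: (real \<Rightarrow> 'a::euclidean_space) measure))"
  (is "_ \<in> borel_measurable ?M")
proof -
  have t [measurable]: "(\<lambda>z. fst z) \<in> borel_measurable ?M"
    by (rule measurable_compose[OF measurable_fst]) (rule measurable_restrict_space1, simp)
  have w [measurable]: "(\<lambda>z. snd z (fst z)) \<in> borel_measurable ?M"
    using path_eval_jointly_measurable unfolding case_prod_beta' .
  have w0 [measurable]: "(\<lambda>z. snd z 0) \<in> borel_measurable ?M"
    by (rule measurable_compose[OF measurable_snd measurable_path_eval]) simp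
  show ?thesis unfolding secant_drift_def case_prod_beta' by measurable
qed

definition straight :: "(real \<Rightarrow> 'a::real_vector) \<Rightarrow> bool" where
  "straight w \<longleftrightarrow> (\<forall>t\<in>{0..1}. w t = w 0 + t *\<^sub>R (w 1 - w 0))"

text \<open>
  Straightness at all times in \<open>{0..1}\<close> is an uncountable conjunction. It is checked on a countable grid of
  times, where each single condition is measurable, and extended by continuity of the paths.
\<close>

lemma AE_straight:
  fixes \<pi> :: "('a::euclidean_space \<times> 'a) measure"
  assumes s: "sets \<pi> = sets borel"
  shows "AE w in distr \<pi> path_space segment_path. straight w"
proof -
  have m: "segment_path \<in> measurable \<pi> path_space"
    using measurable_segment_path by (simp add: measurable_cong_sets[OF s refl])
  define T where "T = range (\<lambda>(i, n). min 1 (real i / real (Suc n)))"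
  have T: "countable T" "T \<subseteq> {0..1}" by (auto simp: T_def)
  have grid: "grid_floor n t \<in> T" for n t by (auto simp: T_def grid_floor_def image_iff)
  have "AE w in distr \<pi> path_space segment_path. \<forall>t\<in>T. norm (w t - (w 0 + t *\<^sub>R (w 1 - w 0))) = 0"
  proof (rule AE_ball_countable'[OF _ T(1)])
    fix t assume "t \<in> T"
    then have t: "t \<in> {0..1}" using T(2) by blast
    have [measurable]: "(\<lambda>w. w t) \<in> borel_measurable (path_space :: (real \<Rightarrow> 'a) measure)"
      "(\<lambda>w. w 0) \<in> borel_measurable (path_space :: (real \<Rightarrow> 'a) measure)"
      "(\<lambda>w. w 1) \<in> borel_measurable (path_space :: (real \<Rightarrow> 'a) measure)"
      using t by (simp_all add: measurable_path_eval)
    show "AE w in distr \<pi> path_space segment_path. norm (w t - (w 0 + t *\<^sub>R (w 1 - w 0))) = 0"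
    proof (subst AE_distr_iff[OF m])
      show "{w \<in> space path_space. norm (w t - (w 0 + t *\<^sub>R (w 1 - w 0))) = 0} \<in> sets (path_space :: (real \<Rightarrow> 'a) measure)"
        by measurable
      show "AE z in \<pi>. norm (segment_path z t - (segment_path z 0 + t *\<^sub>R (segment_path z 1 - segment_path z 0))) = 0"
        using t by (intro AE_I2) (simp add: segment_path_def)
    qed
  qed
  then show ?thesis
  proof (rule AE_mp[OF _ AE_I2], intro impI)
    fix w assume "w \<in> space (distr \<pi> path_space segment_path)"
      and eq: "\<forall>t\<in>T. norm (w t - (w 0 + t *\<^sub>R (w 1 - w 0))) = 0"
    then have w: "continuous_on {0..1} w" by (intro path_space_continuous) simp
    show "straight w" unfolding straight_def
    proof
      fix t :: real assume t: "t \<in> {0..1}"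
      have "w (grid_floor n t) = w 0 + grid_floor n t *\<^sub>R (w 1 - w 0)" for n
        using eq grid[of n t] by simp
      then have "(\<lambda>n. w 0 + grid_floor n t *\<^sub>R (w 1 - w 0)) \<longlonglongrightarrow> w t"
        using path_grid_tendsto[OF w t] by simp
      moreover have "(\<lambda>n. w 0 + grid_floor n t *\<^sub>R (w 1 - w 0)) \<longlonglongrightarrow> w 0 + t *\<^sub>R (w 1 - w 0)"
        by (intro tendsto_intros grid_floor_tendsto t)
      ultimately show "w t = w 0 + t *\<^sub>R (w 1 - w 0)" by (rule LIMSEQ_unique)
    qed
  qed
qed

lemma straightD: "straight w \<Longrightarrow> t \<in> {0..1} \<Longrightarrow> w t = w 0 + t *\<^sub>R (w 1 - w 0)"
  unfolding straight_def by (rule bspec)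

text \<open>
  An equality for every \<open>s\<close>: the half-open interval on the right absorbs the exceptional value of the
  secant drift at \<open>0\<close>.
\<close>

lemma straight_secant_drift:
  assumes "straight w" "t \<in> {0..1}"
  shows "indicator {0..t} s *\<^sub>R secant_drift s w = indicator {0<..t} s *\<^sub>R (w 1 - w 0)"
proof (cases "s \<in> {0<..t}")
  case True
  then have s: "s \<in> {0..1}" "s \<noteq> 0" using assms(2) by simp_all
  then have "w s - w 0 = s *\<^sub>R (w 1 - w 0)" using straightD[OF assms(1) s(1)] by simp
  then have "secant_drift s w = w 1 - w 0" using s(2) by (simp add: secant_drift_def)
  then show ?thesis using True by simp
next
  case False
  then show ?thesis by (cases "s = 0") (auto simp: secant_drift_def indicator_def)
qed

theorem segment_lift:
  fixes \<pi> :: "('a::euclidean_space \<times> 'a) measure"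
  assumes \<pi>: "\<pi> \<in> couplings \<mu>0 \<mu>1" and \<mu>0: "prob_space \<mu>0"
  defines "P \<equiv> distr \<pi> path_space segment_path"
  shows "(P, secant_drift) \<in> BB_admissible \<mu>0 \<mu>1"
    and "action P secant_drift = (\<integral>\<^sup>+(x, y). ennreal ((norm (x - y))\<^sup>2) \<partial>\<pi>)"
proof -
  note s = couplings_sets[OF \<pi>]
  have m: "segment_path \<in> measurable \<pi> path_space"
    using measurable_segment_path by (simp add: measurable_cong_sets[OF s refl])
  have sP: "sets P = sets path_space" by (simp add: P_def)
  have pP: "prob_space P"
    unfolding P_def by (rule prob_space.prob_space_distr[OF couplings_prob_space[OF \<pi> \<mu>0] m])
  have ev: "(\<lambda>w. w t) \<in> borel_measurable P" if "t \<in> {0..1}" for t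
    using measurable_path_eval[OF that] by (simp add: measurable_cong_sets[OF sP refl])
  have AE: "AE w in P. straight w" unfolding P_def by (rule AE_straight[OF s])
  have "drift_process P coordinate_process secant_drift"
    unfolding drift_process_def
  proof (intro conjI ballI)
    show "(\<lambda>(t, w). secant_drift t w) \<in> borel_measurable (restrict_space borel {0..1} \<Otimes>\<^sub>M P)"
      using secant_drift_jointly_measurable
      by (simp add: measurable_cong_sets[OF sets_pair_measure_cong[OF refl sP] refl])
    show "AE w in P. set_integrable lborel {0..1} (\<lambda>s. secant_drift s w) \<and>
        (\<forall>t\<in>{0..1}. w t = w 0 + (LINT s:{0..t}|lborel. secant_drift s w))"
      using AE
    proof eventually_elim
      case (elim w)
      have int: "integrable lborel (\<lambda>s. indicator {0<..1::real} s *\<^sub>R (w 1 - w 0))"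
        by (intro integrable_scaleR_left integrable_real_indicator) simp_all
      have "set_integrable lborel {0..1} (\<lambda>s. secant_drift s w)"
        unfolding set_integrable_def using int straight_secant_drift[OF elim, of 1] by simp
      moreover have "w t = w 0 + (LINT s:{0..t}|lborel. secant_drift s w)" if t: "t \<in> {0..1}" for t
      proof -
        have "(LINT s:{0..t}|lborel. secant_drift s w) = (LINT s|lborel. indicator {0<..t} s *\<^sub>R (w 1 - w 0))"
          unfolding set_lebesgue_integral_def straight_secant_drift[OF elim t] ..
        also have "\<dots> = t *\<^sub>R (w 1 - w 0)"
          using t by (subst integral_scaleR_left) simp_all
        finally have drift: "(LINT s:{0..t}|lborel. secant_drift s w) = t *\<^sub>R (w 1 - w 0)" .
        show ?thesis unfolding drift by (rule straightD[OF elim t])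
      qed
      ultimately show ?case by blast
    qed
  qed (use ev secant_drift_adapted in blast)+
  moreover have "distr P borel (\<lambda>w. w 0) = \<mu>0"
  proof -
    have "distr P borel (\<lambda>w. w 0) = distr \<pi> borel ((\<lambda>w. w 0) \<circ> segment_path)"
      unfolding P_def by (rule distr_distr[OF measurable_path_eval m]) simp
    then show ?thesis by (simp add: comp_def segment_path_ends couplings_fst[OF \<pi>])
  qed
  moreover have "distr P borel (\<lambda>w. w 1) = \<mu>1"
  proof -
    have "distr P borel (\<lambda>w. w 1) = distr \<pi> borel ((\<lambda>w. w 1) \<circ> segment_path)"
      unfolding P_def by (rule distr_distr[OF measurable_path_eval m]) simp
    then show ?thesis by (simp add: comp_def segment_path_ends couplings_snd[OF \<pi>])
  qed
  ultimately show "(P, secant_drift) \<in> BB_admissible \<mu>0 \<mu>1"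
    using pP sP by (simp add: BB_admissible_def)
  have [measurable]: "(\<lambda>w. w 0) \<in> borel_measurable (path_space :: (real \<Rightarrow> 'a) measure)"
    "(\<lambda>w. w 1) \<in> borel_measurable (path_space :: (real \<Rightarrow> 'a) measure)"
    by (simp_all add: measurable_path_eval)
  have "action P secant_drift = (\<integral>\<^sup>+w. ennreal ((norm (w 0 - w 1))\<^sup>2) \<partial>P)"
    unfolding action_def
  proof (rule nn_integral_cong_AE)
    show "AE w in P. (\<integral>\<^sup>+ t\<in>{0..1}. ennreal ((norm (secant_drift t w))\<^sup>2) \<partial>lborel) = ennreal ((norm (w 0 - w 1))\<^sup>2)"
      using AE
    proof eventually_elim
      case (elim w)
      have "ennreal ((norm (secant_drift t w))\<^sup>2) * indicator {0..1} t
          = ennreal ((norm (w 0 - w 1))\<^sup>2) * indicator {0<..1} t" for t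
      proof -
        have "ennreal ((norm (secant_drift t w))\<^sup>2) * indicator {0..1} t
            = ennreal ((norm (indicator {0..1} t *\<^sub>R secant_drift t w))\<^sup>2)"
          by (simp split: split_indicator)
        also have "\<dots> = ennreal ((norm (indicator {0<..1} t *\<^sub>R (w 1 - w 0)))\<^sup>2)"
          using straight_secant_drift[OF elim, of 1 t] by simp
        also have "\<dots> = ennreal ((norm (w 0 - w 1))\<^sup>2) * indicator {0<..1} t"
          by (simp add: norm_minus_commute split: split_indicator)
        finally show ?thesis .
      qed
      then have "(\<integral>\<^sup>+ t\<in>{0..1}. ennreal ((norm (secant_drift t w))\<^sup>2) \<partial>lborel)
          = (\<integral>\<^sup>+ t. ennreal ((norm (w 0 - w 1))\<^sup>2) * indicator {0<..1} t \<partial>(lborel :: real measure))" by simp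
      also have "\<dots> = ennreal ((norm (w 0 - w 1))\<^sup>2)"
        by (subst nn_integral_cmult_indicator) simp_all
      finally show ?case .
    qed
  qed
  also have "\<dots> = (\<integral>\<^sup>+z. ennreal ((norm (segment_path z 0 - segment_path z 1))\<^sup>2) \<partial>\<pi>)"
    unfolding P_def
    by (rule nn_integral_distr[OF m]) measurable
  finally show "action P secant_drift = (\<integral>\<^sup>+(x, y). ennreal ((norm (x - y))\<^sup>2) \<partial>\<pi>)"
    by (simp add: segment_path_ends case_prod_beta')
qed

lemma couplings_integrable_cost:
  fixes \<mu> \<nu> :: "'a::euclidean_space measure"
  assumes \<pi>: "\<pi> \<in> couplings \<mu> \<nu>"
    and \<mu>: "integrable \<mu> (\<lambda>x. (norm x)\<^sup>2)" and \<nu>: "integrable \<nu> (\<lambda>x. (norm x)\<^sup>2)"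
  shows "integrable \<pi> (\<lambda>(x, y). (norm (x - y))\<^sup>2)"
proof (rule Bochner_Integration.integrable_bound)
  have n: "(\<lambda>x :: 'a. (norm x)\<^sup>2) \<in> borel_measurable borel" by measurable
  have "integrable \<pi> (\<lambda>z. (norm (fst z))\<^sup>2)"
    using \<mu> unfolding couplings_fst[OF \<pi>, symmetric] integrable_distr_eq[OF couplings_measurable_fst[OF \<pi>] n] .
  moreover have "integrable \<pi> (\<lambda>z. (norm (snd z))\<^sup>2)"
    using \<nu> unfolding couplings_snd[OF \<pi>, symmetric] integrable_distr_eq[OF couplings_measurable_snd[OF \<pi>] n] .
  ultimately show "integrable \<pi> (\<lambda>z. 2 * (norm (fst z))\<^sup>2 + 2 * (norm (snd z))\<^sup>2)"
    by (intro Bochner_Integration.integrable_add integrable_mult_right)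
  show "(\<lambda>(x, y). (norm (x - y))\<^sup>2) \<in> borel_measurable \<pi>"
    using couplings_measurable_fst[OF \<pi>, measurable] couplings_measurable_snd[OF \<pi>, measurable]
    unfolding case_prod_beta' by measurable
  have "(norm (x - y))\<^sup>2 \<le> 2 * (norm x)\<^sup>2 + 2 * (norm y)\<^sup>2" for x y :: 'a
  proof -
    have "(norm (x - y))\<^sup>2 \<le> (norm x + norm y)\<^sup>2" by (intro power_mono norm_triangle_ineq4) simp
    also have "\<dots> \<le> 2 * (norm x)\<^sup>2 + 2 * (norm y)\<^sup>2"
      using zero_le_power2[of "norm x - norm y"] by (simp add: power2_sum power2_diff)
    finally show ?thesis .
  qed
  then show "AE z in \<pi>. norm (case z of (x, y) \<Rightarrow> (norm (x - y))\<^sup>2) \<le> norm (2 * (norm (fst z))\<^sup>2 + 2 * (norm (snd z))\<^sup>2)"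
    by (intro AE_I2) (simp add: case_prod_beta)
qed

section \<open>Duality and attainment\<close>

theorem theorem6p1:
  fixes \<mu>0 \<mu>1 :: "(real ^ 'n) measure"
  assumes "prob_space \<mu>0" and "sets \<mu>0 = sets borel"
    and "prob_space \<mu>1" and "sets \<mu>1 = sets borel"
    and "integrable \<mu>0 (\<lambda>x. (norm x)\<^sup>2)"
    and "integrable \<mu>1 (\<lambda>x. (norm x)\<^sup>2)"
  shows "enn2ereal (BB2 \<mu>0 \<mu>1) =
           (SUP \<phi>\<in>bcontfun. ereal ((\<integral>x. c_transform \<phi> x \<partial>\<mu>0) - (\<integral>y. \<phi> y \<partial>\<mu>1)))
         \<and> (BB2 \<mu>0 \<mu>1 < \<infinity> \<longrightarrow>
              (\<exists>(P, b) \<in> BB_admissible \<mu>0 \<mu>1. action P b = BB2 \<mu>0 \<mu>1))"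
proof -
  define c :: "(real ^ 'n) \<times> (real ^ 'n) \<Rightarrow> real" where "c = (\<lambda>(x, y). (norm (x - y))\<^sup>2)"
  define dual where "dual \<phi> = (\<integral>x. c_transform \<phi> x \<partial>\<mu>0) - (\<integral>y. \<phi> y \<partial>\<mu>1)" for \<phi> :: "real ^ 'n \<Rightarrow> real"
  have c: "continuous_on UNIV c" "\<And>z. 0 \<le> c z"
    unfolding c_def case_prod_beta by (intro continuous_intros) simp
  obtain \<pi> where \<pi>: "\<pi> \<in> couplings \<mu>0 \<mu>1"
    and opt: "\<And>\<pi>'. \<pi>' \<in> couplings \<mu>0 \<mu>1 \<Longrightarrow> (\<integral>\<^sup>+z. c z \<partial>\<pi>) \<le> (\<integral>\<^sup>+z. c z \<partial>\<pi>')"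
    by (rule optimal_coupling_exists[where c = c, OF assms(1-4) c]) (rule that)
  have int: "integrable \<pi> c"
    unfolding c_def by (rule couplings_integrable_cost[OF \<pi> assms(5,6)])
  have cost: "(\<integral>\<^sup>+z. c z \<partial>\<pi>) = ennreal (\<integral>z. c z \<partial>\<pi>)"
    by (rule nn_integral_eq_integral[OF int]) (simp add: c(2))
  have mono: "cyclically_monotone c (support \<pi>)"
    by (rule optimal_coupling_cyclically_monotone[OF assms(1-4) c \<pi> _ opt]) (simp add: cost)
  obtain \<Phi> where \<Phi>: "\<And>n. \<Phi> n \<in> bcontfun"
    and lim: "(\<lambda>n. (\<integral>x. c_transform (\<Phi> n) x \<partial>\<mu>0) - (\<integral>y. \<Phi> n y \<partial>\<mu>1)) \<longlonglongrightarrow> (\<integral>(x, y). (norm (x - y))\<^sup>2 \<partial>\<pi>)"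
    by (rule cyclically_monotone_dual_approximation[OF assms(1-4) \<pi> int[unfolded c_def]
          AE_support[OF couplings_sets[OF \<pi>]] mono[unfolded c_def]]) (rule that)
  have dual_lim: "(\<lambda>n. dual (\<Phi> n)) \<longlonglongrightarrow> (\<integral>z. c z \<partial>\<pi>)"
    using lim unfolding dual_def c_def .
  define P where "P = distr \<pi> path_space segment_path"
  have adm: "(P, secant_drift) \<in> BB_admissible \<mu>0 \<mu>1"
    and act: "action P secant_drift = ennreal (\<integral>z. c z \<partial>\<pi>)"
    using segment_lift[OF \<pi> assms(1)] cost unfolding P_def c_def by (simp_all add: case_prod_beta')
  have upper: "enn2ereal (action P secant_drift) \<le> (SUP \<phi>\<in>bcontfun. ereal (dual \<phi>))"
  proof -
    have "ereal (\<integral>z. c z \<partial>\<pi>) \<le> (SUP \<phi>\<in>bcontfun. ereal (dual \<phi>))"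
    proof (rule LIMSEQ_le_const2)
      show "(\<lambda>n. ereal (dual (\<Phi> n))) \<longlonglongrightarrow> ereal (\<integral>z. c z \<partial>\<pi>)" using dual_lim by (rule tendsto_ereal)
      show "\<exists>N. \<forall>n\<ge>N. ereal (dual (\<Phi> n)) \<le> (SUP \<phi>\<in>bcontfun. ereal (dual \<phi>))"
        using \<Phi> by (intro exI[of _ 0] allI impI SUP_upper)
    qed
    moreover have "0 \<le> (\<integral>z. c z \<partial>\<pi>)" by (intro integral_nonneg_AE AE_I2 c)
    ultimately show ?thesis unfolding act by (simp add: enn2ereal_ennreal)
  qed
  have weak: "ereal (dual \<phi>) \<le> enn2ereal (BB2 \<mu>0 \<mu>1)" if "\<phi> \<in> bcontfun" for \<phi>
  proof -
    have "e2ennreal (ereal (dual \<phi>)) \<le> BB2 \<mu>0 \<mu>1"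
      unfolding BB2_def
    proof (rule INF_greatest)
      fix Pb assume Pb: "Pb \<in> BB_admissible \<mu>0 \<mu>1"
      then have "(fst Pb, snd Pb) \<in> BB_admissible \<mu>0 \<mu>1" by simp
      then have "ereal (dual \<phi>) \<le> enn2ereal (action (fst Pb) (snd Pb))"
        unfolding dual_def by (rule dual_le_action[OF _ that])
      then have "e2ennreal (ereal (dual \<phi>)) \<le> e2ennreal (enn2ereal (action (fst Pb) (snd Pb)))" by (rule e2ennreal_mono)
      then show "e2ennreal (ereal (dual \<phi>)) \<le> (case Pb of (P, b) \<Rightarrow> action P b)" by (simp add: case_prod_beta)
    qed
    then have "enn2ereal (e2ennreal (ereal (dual \<phi>))) \<le> enn2ereal (BB2 \<mu>0 \<mu>1)" by (simp only: less_eq_ennreal.rep_eq)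
    moreover have "ereal (dual \<phi>) \<le> enn2ereal (e2ennreal (ereal (dual \<phi>)))"
    proof (cases "0 \<le> ereal (dual \<phi>)")
      case True
      then show ?thesis by (simp only: enn2ereal_e2ennreal)
    next
      case False
      then show ?thesis
        using enn2ereal_nonneg[of "e2ennreal (ereal (dual \<phi>))"] by (meson linear order.trans)
    qed
    ultimately show ?thesis by simp
  qed
  have le: "BB2 \<mu>0 \<mu>1 \<le> action P secant_drift"
    unfolding BB2_def using INF_lower[OF adm, of "\<lambda>(P, b). action P b"] by simp
  have eq: "enn2ereal (BB2 \<mu>0 \<mu>1) = (SUP \<phi>\<in>bcontfun. ereal (dual \<phi>))"
  proof (rule antisym)
    show "enn2ereal (BB2 \<mu>0 \<mu>1) \<le> (SUP \<phi>\<in>bcontfun. ereal (dual \<phi>))"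
      using le upper by (simp add: less_eq_ennreal.rep_eq)
    show "(SUP \<phi>\<in>bcontfun. ereal (dual \<phi>)) \<le> enn2ereal (BB2 \<mu>0 \<mu>1)" by (rule SUP_least) (rule weak)
  qed
  moreover have "action P secant_drift = BB2 \<mu>0 \<mu>1"
    using le upper unfolding eq[symmetric] by (simp add: less_eq_ennreal.rep_eq[symmetric])
  ultimately show ?thesis using adm unfolding dual_def by blast
qed

end
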